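(* Let $\mathcal{E}: 0\to I\to E\xrightarrow{\pi}H\to 0$ be an extension of a Rota-Baxter group $(H,R_H)$ by an abelian Rota-Baxter group $(I,R_I)$ such that $[\mathcal{E}]\in\mathrm{Ext}_\mu(H,I)$. Then we have the following exact sequence of groups $$0\to \mathrm{Aut}^{H,I}(E,R_E)\to \mathrm{Aut}_I(E,R_E)\xrightarrow{\rho(\mathcal{E})}\mathrm{C}_\mu\xrightarrow{\omega(\mathcal{E})}\mathrm{H}^2_{RBE}(H,I),$$ where $\omega(\mathcal{E})$ is, in general, only a derivation.
   Context: A Rota-Baxter operator (of weight 1) on a group $G$ is a map $R_G:G\to G$ with $R_G(x)R_G(y)=R_G(xR_G(x)yR_G(x)^{-1})$ for all $x,y$; $(G,R_G)$ is then a Rota-Baxter group. Morphisms are group homomorphisms commuting with the operators; $\mathrm{Aut}(G,R_G)$ is the group of Rota-Baxter automorphisms. Write $x\circ_{R_G}y=xR_G(x)yR_G(x)^{-1}$. A Rota-Baxter extension of $(H,R_H)$ by $(I,R_I)$ is a Rota-Baxter group $(E,R_E)$ with a short exact sequence of groups $0\to I\xrightarrow{i}E\xrightarrow{\pi}H\to 0$ in which $i,\pi$ are morphisms of Rota-Baxter groups; $I$ is identified with $i(I)$. Two extensions are equivalent if there is a Rota-Baxter isomorphism between the middle groups inducing the identity on $I$ and on $H$. An st-section is a map $s:H\to E$ with $\pi s=\mathrm{Id}_H$ sending the identity to the identity. $I$ is abelian (written additively in formulas inside $I$). The action of the extension is the anti-homomorphism $\mu:H\to\mathrm{Aut}(I)$,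 $\mu_h(y)=s(h)^{-1}ys(h)$ (independent of $s$). Throughout, $\mu$ is a fixed action for which $(I,R_I)$ is a right $(H,R_H)$-module, i.e. $\mu_{R_H(h)}(R_I(z))=R_I\big(\mu_{hR_H(h)}(z+R_I(z))-\mu_{R_H(h)}(R_I(z))\big)$ for all $h\in H$, $z\in I$. $\mathrm{Ext}_\mu(H,I)$ is the set of equivalence classes of extensions with action $\mu$. Cohomology: $C^n(H,I)$ is the group of functions $H^n\to I$ vanishing on degenerate tuples (some argument is the identity). For $\theta\in C^1(H,I)$: $(\delta^1\theta)(h_1,h_2)=\theta(h_2)-\theta(h_1h_2)+\mu_{h_2}(\theta(h_1))$, $\Phi^1(\theta)(h)=R_I(\mu_{R_H(h)}(\theta(h)))-\theta(R_H(h))$, $(\partial^1\theta)(h_1,h_2)=\theta(h_2)-\theta(h_1\circ_{R_H}h_2)+\mu_{R_H(h_2)}(\theta(h_1))$. For $f\in C^2(H,I)$: $$\Phi^2(f)(h_1,h_2)=f(R_H(h_1),R_H(h_2))-R_I\Big(\mu_{R_H(h_1\circ_{R_H}h_2)}\big(f(h_1R_H(h_1),h_2R_H(h_1)^{-1})+\mu_{h_2R_H(h_1)^{-1}}(f(h_1,R_H(h_1)))+f(h_2,R_H(h_1)^{-1})-f(R_H(h_1),R_H(h_1)^{-1})\big)\Big).$$ $\mathrm{Z}^2_{RBE}(H,I)$ is the group of pairs $(\tau,g)\in C^2(H,I)\oplus C^1(H,I)$ with $\tau(h_1,h_2h_3)+\tau(h_2,h_3)-\tau(h_1h_2,h_3)-\mu_{h_3}(\tau(h_1,h_2))=0$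 and $(\partial^1g)(h_1,h_2)-R_I\big(\mu_{R_H(h_2)}(\mu_{h_2}(g(h_1))-g(h_1))\big)-\Phi^2(\tau)(h_1,h_2)=0$ for all arguments. $\mathrm{B}^2_{RBE}(H,I)=\{(\delta^1\theta,-\Phi^1(\theta)):\theta\in C^1(H,I)\}$ and $\mathrm{H}^2_{RBE}(H,I)=\mathrm{Z}^2_{RBE}(H,I)/\mathrm{B}^2_{RBE}(H,I)$. For $(\tau,g)\in \mathrm{Z}^2_{RBE}(H,I)$, $\mathcal{E}(\tau,g)$ denotes the extension with middle group $H\times I$, product $(h_1,y_1)(h_2,y_2)=(h_1h_2,\mu_{h_2}(y_1)+y_2+\tau(h_1,h_2))$, operator $R(h,y)=(R_H(h),g(h)+R_I(\mu_{R_H(h)}(y)))$, and natural injection and projection. The set $\mathrm{Ext}_\mu(H,I)$ is identified with $\mathrm{H}^2_{RBE}(H,I)$ through $[(\tau,g)]\leftrightarrow[\mathcal{E}(\tau,g)]$, and $\mathrm{H}^2_{RBE}(H,I)$ acts faithfully and transitively on $\mathrm{Ext}_\mu(H,I)$ by translation, $[\mathcal{E}(\tau,g)]^{[(\tau_1,g_1)]}=[\mathcal{E}(\tau+\tau_1,g+g_1)]$. $\mathrm{C}_\mu=\{(\phi,\psi)\in\mathrm{Aut}(H,R_H)\times\mathrm{Aut}(I,R_I):\mu_h=\psi^{-1}\mu_{\phi(h)}\psi \text{ for all } h\in H\}$. It acts on $\mathrm{Ext}_\mu(H,I)$: $[\mathcal{E}]^{(\phi,\psi)}$ is the class of $0\to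 I\xrightarrow{i\psi}E\xrightarrow{\phi^{-1}\pi}H\to 0$. It acts on $\mathrm{H}^2_{RBE}(H,I)$ by $[(\tau,g)]^{(\phi,\psi)}=[(\tau^{(\phi,\psi)},g^{(\phi,\psi)})]$, where $f^{(\phi,\psi)}(h_1,\dots,h_n)=\psi^{-1}(f(\phi(h_1),\dots,\phi(h_n)))$. The map $\omega(\mathcal{E}):\mathrm{C}_\mu\to\mathrm{H}^2_{RBE}(H,I)$ sends $c$ to the unique $h_c$ with $[\mathcal{E}]^c=[\mathcal{E}]^{h_c}$. Derivation means $\omega(\mathcal{E})(c_1c_2)=\omega(\mathcal{E})(c_1)^{c_2}+\omega(\mathcal{E})(c_2)$; exactness at $\mathrm{C}_\mu$ refers to the set-theoretic kernel $\{c\in\mathrm{C}_\mu:[\mathcal{E}]^c=[\mathcal{E}]\}$ of $\omega(\mathcal{E})$. $\mathrm{Aut}_I(E,R_E)=\{\gamma\in\mathrm{Aut}(E,R_E):\gamma(y)\in I\text{ for all }y\in I\}$ (the automorphisms which normalize $I$). For such $\gamma$, $\gamma_I=\gamma|_I$ and $\gamma_H(h)=\pi(\gamma(s(h)))$ (independent of the st-section $s$) is the induced automorphism of $H$; $\rho(\mathcal{E})(\gamma)=(\gamma_H,\gamma_I)$. $\mathrm{Aut}^{H,I}(E,R_E)=\{\gamma\in\mathrm{Aut}(E,R_E):\gamma_I=\mathrm{Id},\ \gamma_H=\mathrm{Id}\}$, the kernel of $\rho(\mathcal{E})$, and the first map of the sequence is the inclusion.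
   Formalization: The operator of E(τ,g) is taken as R(h,y)=(R_H(h), −g(h)+R_I(μ_{R_H(h)}(y))), since with +g(h) elements of Z²_RBE need not give Rota-Baxter groups; Aut_I(E,R_E) requires γ(I)=I, since for infinite I γ(I)⊆I need not make γ_I an automorphism. *)

theory Defs
  imports "HOL-Algebra.Bij" "HOL-Algebra.Coset" "HOL-Algebra.Product_Groups"
begin

section \<open>Rota-Baxter groups\<close>

definition rb_circ :: "'a monoid \<Rightarrow> ('a \<Rightarrow> 'a) \<Rightarrow> 'a \<Rightarrow> 'a \<Rightarrow> 'a" where
  "rb_circ G R x y = x \<otimes>\<^bsub>G\<^esub> R x \<otimes>\<^bsub>G\<^esub> y \<otimes>\<^bsub>G\<^esub> inv\<^bsub>G\<^esub> (R x)"

locale rota_baxter_group = group G for G :: "'a monoid" (structure) +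
  fixes R :: "'a \<Rightarrow> 'a"
  assumes rb_closed: "R \<in> carrier G \<rightarrow> carrier G"
    and rota_baxter: "\<And>x y. x \<in> carrier G \<Longrightarrow> y \<in> carrier G \<Longrightarrow>
          R x \<otimes> R y = R (x \<otimes> R x \<otimes> y \<otimes> inv (R x))"

definition rb_hom :: "'a monoid \<Rightarrow> ('a \<Rightarrow> 'a) \<Rightarrow> 'b monoid \<Rightarrow> ('b \<Rightarrow> 'b) \<Rightarrow> ('a \<Rightarrow> 'b) set" where
  "rb_hom G R G' R' = {f \<in> hom G G'. \<forall>x\<in>carrier G. f (R x) = R' (f x)}"

definition rb_auto :: "'a monoid \<Rightarrow> ('a \<Rightarrow> 'a) \<Rightarrow> ('a \<Rightarrow> 'a) set" where
  "rb_auto G R = {f \<in> auto G. \<forall>x\<in>carrier G. f (R x) = R (f x)}"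

definition rb_AutoGroup :: "'a monoid \<Rightarrow> ('a \<Rightarrow> 'a) \<Rightarrow> ('a \<Rightarrow> 'a) monoid" where
  "rb_AutoGroup G R = AutoGroup G\<lparr>carrier := rb_auto G R\<rparr>"

text \<open>Abelian kernels are kept in the multiplicative notation of the group library:
  sums in \<open>I\<close> are written with \<open>\<otimes>\<close>, negatives with \<open>inv\<close>.\<close>

locale rb_module =
  H: rota_baxter_group H RH + I: rota_baxter_group I RI + I: comm_group I
  for H :: "'h monoid" and RH and I :: "'i monoid" and RI +
  fixes mu :: "'h \<Rightarrow> 'i \<Rightarrow> 'i"
  assumes mu_iso: "\<And>h. h \<in> carrier H \<Longrightarrow> mu h \<in> iso I I"
    and mu_antihom: "\<And>h1 h2 y. h1 \<in> carrier H \<Longrightarrow> h2 \<in> carrier H \<Longrightarrow> y \<in> carrier I \<Longrightarrow>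
          mu (h1 \<otimes>\<^bsub>H\<^esub> h2) y = mu h2 (mu h1 y)"
    and mu_rb: "\<And>h z. h \<in> carrier H \<Longrightarrow> z \<in> carrier I \<Longrightarrow>
          mu (RH h) (RI z) =
          RI (mu (h \<otimes>\<^bsub>H\<^esub> RH h) (z \<otimes>\<^bsub>I\<^esub> RI z) \<otimes>\<^bsub>I\<^esub> inv\<^bsub>I\<^esub> (mu (RH h) (RI z)))"


section \<open>Extensions\<close>

record ('h, 'i, 'e) rb_ext =
  mid :: "'e monoid"
  rbop :: "'e \<Rightarrow> 'e"
  incl :: "'i \<Rightarrow> 'e"
  proj :: "'e \<Rightarrow> 'h"

definition rb_extension ::
  "'h monoid \<Rightarrow> ('h \<Rightarrow> 'h) \<Rightarrow> 'i monoid \<Rightarrow> ('i \<Rightarrow> 'i) \<Rightarrow> ('h, 'i, 'e) rb_ext \<Rightarrow> bool" where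
  "rb_extension H RH I RI X \<longleftrightarrow>
     rota_baxter_group H RH \<and> rota_baxter_group I RI \<and> rota_baxter_group (mid X) (rbop X) \<and>
     incl X \<in> rb_hom I RI (mid X) (rbop X) \<and> proj X \<in> rb_hom (mid X) (rbop X) H RH \<and>
     inj_on (incl X) (carrier I) \<and>
     incl X ` carrier I = kernel (mid X) H (proj X) \<and>
     proj X ` carrier (mid X) = carrier H"

definition ext_equiv ::
  "'i monoid \<Rightarrow> ('h, 'i, 'e) rb_ext \<Rightarrow> ('h, 'i, 'f) rb_ext \<Rightarrow> bool" where
  "ext_equiv I X Y \<longleftrightarrow>
     (\<exists>f \<in> iso (mid X) (mid Y) \<inter> rb_hom (mid X) (rbop X) (mid Y) (rbop Y).
        (\<forall>y\<in>carrier I. f (incl X y) = incl Y y) \<and>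
        (\<forall>x\<in>carrier (mid X). proj Y (f x) = proj X x))"

definition st_section :: "'h monoid \<Rightarrow> ('h, 'i, 'e) rb_ext \<Rightarrow> ('h \<Rightarrow> 'e) \<Rightarrow> bool" where
  "st_section H X s \<longleftrightarrow>
     s \<in> carrier H \<rightarrow> carrier (mid X) \<and> (\<forall>h\<in>carrier H. proj X (s h) = h) \<and>
     s \<one>\<^bsub>H\<^esub> = \<one>\<^bsub>mid X\<^esub>"

definition has_action ::
  "'h monoid \<Rightarrow> 'i monoid \<Rightarrow> ('h, 'i, 'e) rb_ext \<Rightarrow> ('h \<Rightarrow> 'i \<Rightarrow> 'i) \<Rightarrow> bool" where
  "has_action H I X mu \<longleftrightarrow>
     (\<forall>s. st_section H X s \<longrightarrow> (\<forall>h\<in>carrier H. \<forall>y\<in>carrier I.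
        incl X (mu h y) = inv\<^bsub>mid X\<^esub> (s h) \<otimes>\<^bsub>mid X\<^esub> incl X y \<otimes>\<^bsub>mid X\<^esub> s h))"

text \<open>The class of an extension whose middle group lives on an arbitrary type is represented by
  its members on the type \<^typ>\<open>'h \<times> 'i\<close>; no class is lost, since a section identifies
  every middle group with \<open>H \<times> I\<close> as a set.\<close>

definition ext_class ::
  "'h monoid \<Rightarrow> ('h \<Rightarrow> 'h) \<Rightarrow> 'i monoid \<Rightarrow> ('i \<Rightarrow> 'i) \<Rightarrow> ('h, 'i, 'e) rb_ext \<Rightarrow>
   ('h, 'i, 'h \<times> 'i) rb_ext set" where
  "ext_class H RH I RI X = {Y. rb_extension H RH I RI Y \<and> ext_equiv I X Y}"

definition Ext_mu ::
  "'h monoid \<Rightarrow> ('h \<Rightarrow> 'h) \<Rightarrow> 'i monoid \<Rightarrow> ('i \<Rightarrow> 'i) \<Rightarrow> ('h \<Rightarrow> 'i \<Rightarrow> 'i) \<Rightarrow>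
   ('h, 'i, 'h \<times> 'i) rb_ext set set" where
  "Ext_mu H RH I RI mu =
     {ext_class H RH I RI Y | Y :: ('h, 'i, 'h \<times> 'i) rb_ext.
        rb_extension H RH I RI Y \<and> has_action H I Y mu}"


section \<open>Cohomology\<close>

definition C1 :: "'h monoid \<Rightarrow> 'i monoid \<Rightarrow> ('h \<Rightarrow> 'i) monoid" where
  "C1 H I = (product_group (carrier H) (\<lambda>_. I))
     \<lparr>carrier := {t \<in> carrier H \<rightarrow>\<^sub>E carrier I. t \<one>\<^bsub>H\<^esub> = \<one>\<^bsub>I\<^esub>}\<rparr>"

definition C2 :: "'h monoid \<Rightarrow> 'i monoid \<Rightarrow> ('h \<times> 'h \<Rightarrow> 'i) monoid" where
  "C2 H I = (product_group (carrier H \<times> carrier H) (\<lambda>_. I))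
     \<lparr>carrier := {f \<in> carrier H \<times> carrier H \<rightarrow>\<^sub>E carrier I.
        \<forall>h\<in>carrier H. f (h, \<one>\<^bsub>H\<^esub>) = \<one>\<^bsub>I\<^esub> \<and> f (\<one>\<^bsub>H\<^esub>, h) = \<one>\<^bsub>I\<^esub>}\<rparr>"

definition delta1 ::
  "'h monoid \<Rightarrow> 'i monoid \<Rightarrow> ('h \<Rightarrow> 'i \<Rightarrow> 'i) \<Rightarrow> ('h \<Rightarrow> 'i) \<Rightarrow> 'h \<times> 'h \<Rightarrow> 'i" where
  "delta1 H I mu t = restrict
     (\<lambda>(h1, h2). t h2 \<otimes>\<^bsub>I\<^esub> inv\<^bsub>I\<^esub> (t (h1 \<otimes>\<^bsub>H\<^esub> h2)) \<otimes>\<^bsub>I\<^esub> mu h2 (t h1))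
     (carrier H \<times> carrier H)"

definition Phi1 ::
  "'h monoid \<Rightarrow> ('h \<Rightarrow> 'h) \<Rightarrow> 'i monoid \<Rightarrow> ('i \<Rightarrow> 'i) \<Rightarrow> ('h \<Rightarrow> 'i \<Rightarrow> 'i) \<Rightarrow>
   ('h \<Rightarrow> 'i) \<Rightarrow> 'h \<Rightarrow> 'i" where
  "Phi1 H RH I RI mu t =
     (\<lambda>h\<in>carrier H. RI (mu (RH h) (t h)) \<otimes>\<^bsub>I\<^esub> inv\<^bsub>I\<^esub> (t (RH h)))"

definition partial1 ::
  "'h monoid \<Rightarrow> ('h \<Rightarrow> 'h) \<Rightarrow> 'i monoid \<Rightarrow> ('h \<Rightarrow> 'i \<Rightarrow> 'i) \<Rightarrow>
   ('h \<Rightarrow> 'i) \<Rightarrow> 'h \<times> 'h \<Rightarrow> 'i" where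
  "partial1 H RH I mu t = restrict
     (\<lambda>(h1, h2). t h2 \<otimes>\<^bsub>I\<^esub> inv\<^bsub>I\<^esub> (t (rb_circ H RH h1 h2)) \<otimes>\<^bsub>I\<^esub> mu (RH h2) (t h1))
     (carrier H \<times> carrier H)"

definition Phi2 ::
  "'h monoid \<Rightarrow> ('h \<Rightarrow> 'h) \<Rightarrow> 'i monoid \<Rightarrow> ('i \<Rightarrow> 'i) \<Rightarrow> ('h \<Rightarrow> 'i \<Rightarrow> 'i) \<Rightarrow>
   ('h \<times> 'h \<Rightarrow> 'i) \<Rightarrow> 'h \<times> 'h \<Rightarrow> 'i" where
  "Phi2 H RH I RI mu f = restrict
     (\<lambda>(h1, h2). f (RH h1, RH h2) \<otimes>\<^bsub>I\<^esub> inv\<^bsub>I\<^esub> (RI (mu (RH (rb_circ H RH h1 h2))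
        (f (h1 \<otimes>\<^bsub>H\<^esub> RH h1, h2 \<otimes>\<^bsub>H\<^esub> inv\<^bsub>H\<^esub> (RH h1))
         \<otimes>\<^bsub>I\<^esub> mu (h2 \<otimes>\<^bsub>H\<^esub> inv\<^bsub>H\<^esub> (RH h1)) (f (h1, RH h1))
         \<otimes>\<^bsub>I\<^esub> f (h2, inv\<^bsub>H\<^esub> (RH h1))
         \<otimes>\<^bsub>I\<^esub> inv\<^bsub>I\<^esub> (f (RH h1, inv\<^bsub>H\<^esub> (RH h1)))))))
     (carrier H \<times> carrier H)"

definition Z2 ::
  "'h monoid \<Rightarrow> ('h \<Rightarrow> 'h) \<Rightarrow> 'i monoid \<Rightarrow> ('i \<Rightarrow> 'i) \<Rightarrow> ('h \<Rightarrow> 'i \<Rightarrow> 'i) \<Rightarrow>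
   (('h \<times> 'h \<Rightarrow> 'i) \<times> ('h \<Rightarrow> 'i)) monoid" where
  "Z2 H RH I RI mu = (C2 H I \<times>\<times> C1 H I)\<lparr>carrier :=
     {(t, g). t \<in> carrier (C2 H I) \<and> g \<in> carrier (C1 H I) \<and>
        (\<forall>h1\<in>carrier H. \<forall>h2\<in>carrier H. \<forall>h3\<in>carrier H.
           t (h1, h2 \<otimes>\<^bsub>H\<^esub> h3) \<otimes>\<^bsub>I\<^esub> t (h2, h3) \<otimes>\<^bsub>I\<^esub> inv\<^bsub>I\<^esub> (t (h1 \<otimes>\<^bsub>H\<^esub> h2, h3))
           \<otimes>\<^bsub>I\<^esub> inv\<^bsub>I\<^esub> (mu h3 (t (h1, h2))) = \<one>\<^bsub>I\<^esub>) \<and>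
        (\<forall>h1\<in>carrier H. \<forall>h2\<in>carrier H.
           partial1 H RH I mu g (h1, h2)
           \<otimes>\<^bsub>I\<^esub> inv\<^bsub>I\<^esub> (RI (mu (RH h2) (mu h2 (g h1) \<otimes>\<^bsub>I\<^esub> inv\<^bsub>I\<^esub> (g h1))))
           \<otimes>\<^bsub>I\<^esub> inv\<^bsub>I\<^esub> (Phi2 H RH I RI mu t (h1, h2)) = \<one>\<^bsub>I\<^esub>)}\<rparr>"

definition B2 ::
  "'h monoid \<Rightarrow> ('h \<Rightarrow> 'h) \<Rightarrow> 'i monoid \<Rightarrow> ('i \<Rightarrow> 'i) \<Rightarrow> ('h \<Rightarrow> 'i \<Rightarrow> 'i) \<Rightarrow>
   (('h \<times> 'h \<Rightarrow> 'i) \<times> ('h \<Rightarrow> 'i)) set" where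
  "B2 H RH I RI mu =
     {(delta1 H I mu t, \<lambda>h\<in>carrier H. inv\<^bsub>I\<^esub> (Phi1 H RH I RI mu t h)) | t. t \<in> carrier (C1 H I)}"

definition H2 ::
  "'h monoid \<Rightarrow> ('h \<Rightarrow> 'h) \<Rightarrow> 'i monoid \<Rightarrow> ('i \<Rightarrow> 'i) \<Rightarrow> ('h \<Rightarrow> 'i \<Rightarrow> 'i) \<Rightarrow>
   (('h \<times> 'h \<Rightarrow> 'i) \<times> ('h \<Rightarrow> 'i)) set monoid" where
  "H2 H RH I RI mu = Z2 H RH I RI mu Mod B2 H RH I RI mu"

text \<open>The extension attached to a cocycle \<open>(t, g)\<close>.  The operator sends the section element
  \<open>(h, 1)\<close> to \<open>(RH h, inv (g h))\<close>: in the total complex giving \<open>Z2\<close> and \<open>B2\<close> above,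
  the component \<open>Phi\<close> carries a minus sign, and the Rota-Baxter identity for this
  operator is then exactly the second cocycle condition.  With \<open>g h\<close> in place of \<open>inv (g h)\<close>
  it would be that condition with the opposite sign in front of \<open>Phi2\<close>.\<close>

definition ext_of_cocycle ::
  "'h monoid \<Rightarrow> ('h \<Rightarrow> 'h) \<Rightarrow> 'i monoid \<Rightarrow> ('i \<Rightarrow> 'i) \<Rightarrow> ('h \<Rightarrow> 'i \<Rightarrow> 'i) \<Rightarrow>
   ('h \<times> 'h \<Rightarrow> 'i) \<times> ('h \<Rightarrow> 'i) \<Rightarrow> ('h, 'i, 'h \<times> 'i) rb_ext" where
  "ext_of_cocycle H RH I RI mu = (\<lambda>(t, g).
     \<lparr>mid = \<lparr>carrier = carrier H \<times> carrier I,
             mult = (\<lambda>(h1, y1) (h2, y2).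
               (h1 \<otimes>\<^bsub>H\<^esub> h2, mu h2 y1 \<otimes>\<^bsub>I\<^esub> y2 \<otimes>\<^bsub>I\<^esub> t (h1, h2))),
             one = (\<one>\<^bsub>H\<^esub>, \<one>\<^bsub>I\<^esub>)\<rparr>,
      rbop = (\<lambda>(h, y). (RH h, inv\<^bsub>I\<^esub> (g h) \<otimes>\<^bsub>I\<^esub> RI (mu (RH h) y))),
      incl = (\<lambda>y. (\<one>\<^bsub>H\<^esub>, y)),
      proj = fst\<rparr>)"

text \<open>Action of \<open>H2\<close> on \<open>Ext_mu\<close>; \<^const>\<open>the_elem\<close> expresses the definition by representatives.\<close>

definition ext_translate ::
  "'h monoid \<Rightarrow> ('h \<Rightarrow> 'h) \<Rightarrow> 'i monoid \<Rightarrow> ('i \<Rightarrow> 'i) \<Rightarrow> ('h \<Rightarrow> 'i \<Rightarrow> 'i) \<Rightarrow>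
   ('h, 'i, 'h \<times> 'i) rb_ext set \<Rightarrow> (('h \<times> 'h \<Rightarrow> 'i) \<times> ('h \<Rightarrow> 'i)) set \<Rightarrow>
   ('h, 'i, 'h \<times> 'i) rb_ext set" where
  "ext_translate H RH I RI mu c k = the_elem
     {ext_class H RH I RI (ext_of_cocycle H RH I RI mu (p \<otimes>\<^bsub>Z2 H RH I RI mu\<^esub> q)) | p q.
        p \<in> carrier (Z2 H RH I RI mu) \<and>
        ext_class H RH I RI (ext_of_cocycle H RH I RI mu p) = c \<and> q \<in> k}"


section \<open>Compatible pairs and the map \<open>\<omega>\<close>\<close>

definition C_mu ::
  "'h monoid \<Rightarrow> ('h \<Rightarrow> 'h) \<Rightarrow> 'i monoid \<Rightarrow> ('i \<Rightarrow> 'i) \<Rightarrow> ('h \<Rightarrow> 'i \<Rightarrow> 'i) \<Rightarrow>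
   (('h \<Rightarrow> 'h) \<times> ('i \<Rightarrow> 'i)) monoid" where
  "C_mu H RH I RI mu = (rb_AutoGroup H RH \<times>\<times> rb_AutoGroup I RI)\<lparr>carrier :=
     {(\<phi>, \<psi>). \<phi> \<in> rb_auto H RH \<and> \<psi> \<in> rb_auto I RI \<and>
        (\<forall>h\<in>carrier H. \<forall>y\<in>carrier I. mu h y = inv_into (carrier I) \<psi> (mu (\<phi> h) (\<psi> y)))}\<rparr>"

definition ext_twist ::
  "'h monoid \<Rightarrow> ('h, 'i, 'e) rb_ext \<Rightarrow> ('h \<Rightarrow> 'h) \<times> ('i \<Rightarrow> 'i) \<Rightarrow> ('h, 'i, 'e) rb_ext" where
  "ext_twist H X = (\<lambda>(\<phi>, \<psi>).
     X\<lparr>incl := incl X \<circ> \<psi>, proj := inv_into (carrier H) \<phi> \<circ> proj X\<rparr>)"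

definition cocycle_twist ::
  "'h monoid \<Rightarrow> 'i monoid \<Rightarrow> ('h \<Rightarrow> 'h) \<times> ('i \<Rightarrow> 'i) \<Rightarrow>
   ('h \<times> 'h \<Rightarrow> 'i) \<times> ('h \<Rightarrow> 'i) \<Rightarrow> ('h \<times> 'h \<Rightarrow> 'i) \<times> ('h \<Rightarrow> 'i)" where
  "cocycle_twist H I = (\<lambda>(\<phi>, \<psi>) (t, g).
     (restrict (\<lambda>(h1, h2). inv_into (carrier I) \<psi> (t (\<phi> h1, \<phi> h2))) (carrier H \<times> carrier H),
      \<lambda>h\<in>carrier H. inv_into (carrier I) \<psi> (g (\<phi> h))))"

definition H2_act ::
  "'h monoid \<Rightarrow> ('h \<Rightarrow> 'h) \<Rightarrow> 'i monoid \<Rightarrow> ('i \<Rightarrow> 'i) \<Rightarrow> ('h \<Rightarrow> 'i \<Rightarrow> 'i) \<Rightarrow>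
   (('h \<times> 'h \<Rightarrow> 'i) \<times> ('h \<Rightarrow> 'i)) set \<Rightarrow> ('h \<Rightarrow> 'h) \<times> ('i \<Rightarrow> 'i) \<Rightarrow>
   (('h \<times> 'h \<Rightarrow> 'i) \<times> ('h \<Rightarrow> 'i)) set" where
  "H2_act H RH I RI mu k c = the_elem
     ((\<lambda>p. B2 H RH I RI mu #>\<^bsub>Z2 H RH I RI mu\<^esub> cocycle_twist H I c p) ` k)"

definition omega ::
  "'h monoid \<Rightarrow> ('h \<Rightarrow> 'h) \<Rightarrow> 'i monoid \<Rightarrow> ('i \<Rightarrow> 'i) \<Rightarrow> ('h \<Rightarrow> 'i \<Rightarrow> 'i) \<Rightarrow>
   ('h, 'i, 'e) rb_ext \<Rightarrow> ('h \<Rightarrow> 'h) \<times> ('i \<Rightarrow> 'i) \<Rightarrow> (('h \<times> 'h \<Rightarrow> 'i) \<times> ('h \<Rightarrow> 'i)) set" where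
  "omega H RH I RI mu X c = (THE k. k \<in> carrier (H2 H RH I RI mu) \<and>
     ext_class H RH I RI (ext_twist H X c) =
     ext_translate H RH I RI mu (ext_class H RH I RI X) k)"


section \<open>Automorphisms of an extension\<close>

text \<open>Automorphisms normalizing \<open>I\<close> map it onto itself.  Mere inclusion of the image in \<open>I\<close>
  would, for infinite \<open>I\<close>, not ensure that the induced maps on \<open>I\<close> and \<open>H\<close> are bijective.\<close>

definition Aut_I :: "'i monoid \<Rightarrow> ('h, 'i, 'e) rb_ext \<Rightarrow> ('e \<Rightarrow> 'e) monoid" where
  "Aut_I I X = (rb_AutoGroup (mid X) (rbop X))\<lparr>carrier :=
     {\<gamma> \<in> rb_auto (mid X) (rbop X). \<gamma> ` (incl X ` carrier I) = incl X ` carrier I}\<rparr>"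

definition aut_restr :: "'i monoid \<Rightarrow> ('h, 'i, 'e) rb_ext \<Rightarrow> ('e \<Rightarrow> 'e) \<Rightarrow> 'i \<Rightarrow> 'i" where
  "aut_restr I X \<gamma> = (\<lambda>y\<in>carrier I. inv_into (carrier I) (incl X) (\<gamma> (incl X y)))"

definition aut_ind ::
  "'h monoid \<Rightarrow> ('h, 'i, 'e) rb_ext \<Rightarrow> ('h \<Rightarrow> 'e) \<Rightarrow> ('e \<Rightarrow> 'e) \<Rightarrow> 'h \<Rightarrow> 'h" where
  "aut_ind H X s \<gamma> = (\<lambda>h\<in>carrier H. proj X (\<gamma> (s h)))"

definition Aut_HI ::
  "'h monoid \<Rightarrow> 'i monoid \<Rightarrow> ('h, 'i, 'e) rb_ext \<Rightarrow> ('h \<Rightarrow> 'e) \<Rightarrow> ('e \<Rightarrow> 'e) monoid" where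
  "Aut_HI H I X s = (rb_AutoGroup (mid X) (rbop X))\<lparr>carrier :=
     {\<gamma> \<in> carrier (Aut_I I X).
        aut_restr I X \<gamma> = (\<lambda>y\<in>carrier I. y) \<and> aut_ind H X s \<gamma> = (\<lambda>h\<in>carrier H. h)}\<rparr>"

definition rho ::
  "'h monoid \<Rightarrow> 'i monoid \<Rightarrow> ('h, 'i, 'e) rb_ext \<Rightarrow> ('h \<Rightarrow> 'e) \<Rightarrow> ('e \<Rightarrow> 'e) \<Rightarrow>
   ('h \<Rightarrow> 'h) \<times> ('i \<Rightarrow> 'i)" where
  "rho H I X s \<gamma> = (aut_ind H X s \<gamma>, aut_restr I X \<gamma>)"

end

theory Submission
  imports Defs
begin

text \<open>A section \<open>s\<close> turns the middle group into \<open>H \<times> I\<close> with the structure of a cocycle \<open>p\<close>;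
  a pair of cochains is a cocycle exactly when this structure is a Rota-Baxter group, and two such
  structures are equivalent exactly when the cocycles differ by a coboundary.  Twisting the
  extension by \<open>c = (\<phi>, \<psi>)\<close> twists the cocycle, because \<open>(h, y) \<mapsto> (\<phi> h, \<psi> y)\<close> is an isomorphism.
  Hence \<open>\<omega> c\<close> is the class of \<open>p\<^sup>c - p\<close>, which makes the derivation rule immediate, and
  \<open>\<omega> c = 0\<close> says that the extension is equivalent to its twist by \<open>c\<close>.  Such an
  equivalence is the same thing as an automorphism normalizing \<open>I\<close> that induces \<open>c\<close>.\<close>

section \<open>Commutative groups\<close>

text \<open>The conditions in \<open>Z2\<close> are compared with the group and Rota-Baxter axioms
  once, as equivalences (\<open>Z2_iff\<close>). Afterwards cochains are recognised as cocycles by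
  transport of structure: it suffices that their structure on pairs embeds, compatibly with product
  and operator, into a known Rota-Baxter group (\<open>pullback_in_Z2\<close>). Coboundaries,
  twisted cocycles and the cocycle of a section are all obtained in this way, without expanding
  \<open>Phi2\<close> again; only sums and negatives of cocycles are checked on the equations
  themselves. Two features of the encoding shape the rest. Classes contain only extensions on the
  type \<open>'h \<times> 'i\<close>, so an arbitrary extension does not lie in its own class, and
  equality of classes is turned into an equivalence by way of some \<open>E p\<close>. Moreover
  \<open>ext_translate\<close>, \<open>H2_act\<close> and \<open>omega\<close> are given by
  \<open>the_elem\<close> and \<open>THE\<close>, so each can be computed only after independence of
  representatives, or unique existence, has been proved.\<close>

lemma (in group) eq_conj_iff:
  assumes "x \<in> carrier G" "a \<in> carrier G" "b \<in> carrier G"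
  shows "a = inv x \<otimes> b \<otimes> x \<longleftrightarrow> x \<otimes> a = b \<otimes> x"
  using assms inv_solve_left[of a x "b \<otimes> x"] by (auto simp: m_assoc)

context comm_group
begin

text \<open>A form of subtraction that simp leaves folded. The rules below collect all inverses in
  one outer quotient and then cross-multiply, so that an equation with negatives becomes an equation
  of sums, which associativity and commutativity decide.\<close>

definition quot :: "'a \<Rightarrow> 'a \<Rightarrow> 'a" where
  "quot x y = x \<otimes> inv y"

lemma quot_closed [simp]: "x \<in> carrier G \<Longrightarrow> y \<in> carrier G \<Longrightarrow> quot x y \<in> carrier G"
  by (simp add: quot_def)

lemma quot_simps:
  assumes "x \<in> carrier G" "y \<in> carrier G" "z \<in> carrier G"
  shows "x \<otimes> quot y z = quot (x \<otimes> y) z"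
    and "quot y z \<otimes> x = quot (y \<otimes> x) z"
    and "quot (quot x y) z = quot x (y \<otimes> z)"
    and "quot x (quot y z) = quot (x \<otimes> z) y"
    and "quot x y = z \<longleftrightarrow> x = z \<otimes> y"
    and "z = quot x y \<longleftrightarrow> z \<otimes> y = x"
proof -
  show "x \<otimes> quot y z = quot (x \<otimes> y) z" "quot y z \<otimes> x = quot (y \<otimes> x) z"
    "quot (quot x y) z = quot x (y \<otimes> z)" "quot x (quot y z) = quot (x \<otimes> z) y"
    using assms by (simp_all add: quot_def inv_mult m_ac)
  show "quot x y = z \<longleftrightarrow> x = z \<otimes> y" "z = quot x y \<longleftrightarrow> z \<otimes> y = x"
    using assms by (auto simp: quot_def m_assoc)
qed

lemma inv_eq_quot: "x \<in> carrier G \<Longrightarrow> inv x = quot \<one> x"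
  by (simp add: quot_def)

lemma rcos_eq_iff:
  assumes "subgroup N G" "x \<in> carrier G" "y \<in> carrier G"
  shows "N #> x = N #> y \<longleftrightarrow> x \<otimes> inv y \<in> N"
  using assms subgroup.rcos_module[OF assms(1) is_group assms(3,2)]
    repr_independence[of x N y] rcos_self[of x N] by auto

end

section \<open>The structure on pairs\<close>

lemma (in rota_baxter_group) R_closed [simp]: "x \<in> carrier G \<Longrightarrow> R x \<in> carrier G"
  using rb_closed by auto

context rb_module
begin

abbreviation mulH (infixl "\<cdot>" 70) where "x \<cdot> y \<equiv> x \<otimes>\<^bsub>H\<^esub> y"
abbreviation addI (infixl "\<^bold>+" 65) where "x \<^bold>+ y \<equiv> x \<otimes>\<^bsub>I\<^esub> y"
abbreviation uminusI ("\<^bold>- _" [81] 80) where "\<^bold>- x \<equiv> inv\<^bsub>I\<^esub> x"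
abbreviation zeroI ("\<^bold>0") where "\<^bold>0 \<equiv> \<one>\<^bsub>I\<^esub>"

abbreviation "E \<equiv> ext_of_cocycle H RH I RI mu"
abbreviation "Z \<equiv> Z2 H RH I RI mu"
abbreviation "B \<equiv> B2 H RH I RI mu"

lemma mu_closed [simp]: "h \<in> carrier H \<Longrightarrow> y \<in> carrier I \<Longrightarrow> mu h y \<in> carrier I"
  using mu_iso[of h] by (auto simp: iso_def hom_def)

lemma mu_hom: "h \<in> carrier H \<Longrightarrow> group_hom I I (mu h)"
  using mu_iso[of h] by (auto simp: iso_def group_hom_def group_hom_axioms_def)

lemma mu_add [simp]:
  "h \<in> carrier H \<Longrightarrow> x \<in> carrier I \<Longrightarrow> y \<in> carrier I \<Longrightarrow> mu h (x \<^bold>+ y) = mu h x \<^bold>+ mu h y"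
  by (rule group_hom.hom_mult[OF mu_hom])

lemma mu_zero [simp]: "h \<in> carrier H \<Longrightarrow> mu h \<^bold>0 = \<^bold>0"
  by (rule group_hom.hom_one[OF mu_hom])

lemma mu_uminus [simp]: "h \<in> carrier H \<Longrightarrow> x \<in> carrier I \<Longrightarrow> mu h (\<^bold>- x) = \<^bold>- mu h x"
  by (rule group_hom.hom_inv[OF mu_hom])

text \<open>The antihomomorphism law makes \<open>mu\<close> at the identity idempotent, and an
  injective idempotent map is the identity.\<close>

lemma mu_one [simp]: "y \<in> carrier I \<Longrightarrow> mu \<one>\<^bsub>H\<^esub> y = y"
proof -
  assume y: "y \<in> carrier I"
  have "mu \<one>\<^bsub>H\<^esub> (mu \<one>\<^bsub>H\<^esub> y) = mu \<one>\<^bsub>H\<^esub> y"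
    using mu_antihom[of "\<one>\<^bsub>H\<^esub>" "\<one>\<^bsub>H\<^esub>" y] y by simp
  then show ?thesis
    using mu_iso[of "\<one>\<^bsub>H\<^esub>"] y by (auto simp: iso_def bij_betw_def dest: inj_onD)
qed

lemma mu_mu [simp]:
  "h \<in> carrier H \<Longrightarrow> k \<in> carrier H \<Longrightarrow> y \<in> carrier I \<Longrightarrow> mu k (mu h y) = mu (h \<cdot> k) y"
  by (simp add: mu_antihom)

text \<open>At the identity the conjugating factors in the Rota-Baxter identity cancel, so the value
  of \<open>RH\<close> there is an idempotent element of a group.\<close>

lemma RH_one [simp]: "RH \<one>\<^bsub>H\<^esub> = \<one>\<^bsub>H\<^esub>"
proof -
  have "RH \<one>\<^bsub>H\<^esub> \<cdot> RH \<one>\<^bsub>H\<^esub> = RH \<one>\<^bsub>H\<^esub>"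
    using H.rota_baxter[of "\<one>\<^bsub>H\<^esub>" "\<one>\<^bsub>H\<^esub>"] by simp
  then show ?thesis by simp
qed

lemma rb_circ_closed [simp]:
  "h \<in> carrier H \<Longrightarrow> k \<in> carrier H \<Longrightarrow> rb_circ H RH h k \<in> carrier H"
  by (simp add: rb_circ_def)

lemma RH_circ [simp]:
  "h \<in> carrier H \<Longrightarrow> k \<in> carrier H \<Longrightarrow> RH (rb_circ H RH h k) = RH h \<cdot> RH k"
  by (simp add: rb_circ_def H.rota_baxter)

text \<open>On an abelian group a Rota-Baxter operator is an endomorphism.\<close>

lemma RI_hom: "group_hom I I RI"
proof -
  have "RI (x \<^bold>+ y) = RI x \<^bold>+ RI y" if "x \<in> carrier I" "y \<in> carrier I" for x y
    using I.rota_baxter[of x y] that by (simp add: I.m_ac)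
  then show ?thesis by unfold_locales (auto simp: hom_def)
qed

lemma RI_add [simp]: "x \<in> carrier I \<Longrightarrow> y \<in> carrier I \<Longrightarrow> RI (x \<^bold>+ y) = RI x \<^bold>+ RI y"
  by (rule group_hom.hom_mult[OF RI_hom])

lemma RI_zero [simp]: "RI \<^bold>0 = \<^bold>0"
  by (rule group_hom.hom_one[OF RI_hom])

lemma RI_uminus [simp]: "x \<in> carrier I \<Longrightarrow> RI (\<^bold>- x) = \<^bold>- RI x"
  by (rule group_hom.hom_inv[OF RI_hom])

lemma quot_hom:
  assumes "x \<in> carrier I" "y \<in> carrier I"
  shows "h \<in> carrier H \<Longrightarrow> mu h (I.quot x y) = I.quot (mu h x) (mu h y)"
    and "RI (I.quot x y) = I.quot (RI x) (RI y)"
  using assms by (simp_all add: I.quot_def)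

lemma C1_closed: "g \<in> carrier (C1 H I) \<Longrightarrow> h \<in> carrier H \<Longrightarrow> g h \<in> carrier I"
  by (auto simp: C1_def)

lemma C1_one: "g \<in> carrier (C1 H I) \<Longrightarrow> g \<one>\<^bsub>H\<^esub> = \<^bold>0"
  by (simp add: C1_def)

lemma C2_closed:
  "t \<in> carrier (C2 H I) \<Longrightarrow> h \<in> carrier H \<Longrightarrow> k \<in> carrier H \<Longrightarrow> t (h, k) \<in> carrier I"
  by (auto simp: C2_def)

lemma C2_one:
  "t \<in> carrier (C2 H I) \<Longrightarrow> h \<in> carrier H \<Longrightarrow> t (h, \<one>\<^bsub>H\<^esub>) = \<^bold>0"
  "t \<in> carrier (C2 H I) \<Longrightarrow> h \<in> carrier H \<Longrightarrow> t (\<one>\<^bsub>H\<^esub>, h) = \<^bold>0"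
  by (simp_all add: C2_def)

lemmas C_simps = C1_closed C1_one C2_closed C2_one

text \<open>The two cocycle conditions with all terms moved to the side on which they are positive.\<close>

lemma Z2_carrier:
  "(t, g) \<in> carrier Z \<longleftrightarrow> t \<in> carrier (C2 H I) \<and> g \<in> carrier (C1 H I) \<and>
     (\<forall>h1\<in>carrier H. \<forall>h2\<in>carrier H. \<forall>h3\<in>carrier H.
        t (h1, h2 \<cdot> h3) \<^bold>+ t (h2, h3) = t (h1 \<cdot> h2, h3) \<^bold>+ mu h3 (t (h1, h2))) \<and>
     (\<forall>h1\<in>carrier H. \<forall>h2\<in>carrier H.
        g h2 \<^bold>+ mu (RH h2) (g h1) \<^bold>+ RI (mu (RH h2) (g h1))
        \<^bold>+ RI (mu (RH h1 \<cdot> RH h2) (t (h1 \<cdot> RH h1, h2 \<cdot> inv\<^bsub>H\<^esub> RH h1)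
            \<^bold>+ mu (h2 \<cdot> inv\<^bsub>H\<^esub> RH h1) (t (h1, RH h1)) \<^bold>+ t (h2, inv\<^bsub>H\<^esub> RH h1)))
        = g (rb_circ H RH h1 h2) \<^bold>+ RI (mu (h2 \<cdot> RH h2) (g h1)) \<^bold>+ t (RH h1, RH h2)
        \<^bold>+ RI (mu (RH h1 \<cdot> RH h2) (t (RH h1, inv\<^bsub>H\<^esub> RH h1))))"
proof -
  have 1: "t (h1, h2 \<cdot> h3) \<^bold>+ t (h2, h3) \<^bold>+ \<^bold>- t (h1 \<cdot> h2, h3) \<^bold>+ \<^bold>- mu h3 (t (h1, h2)) = \<^bold>0 \<longleftrightarrow>
      t (h1, h2 \<cdot> h3) \<^bold>+ t (h2, h3) = t (h1 \<cdot> h2, h3) \<^bold>+ mu h3 (t (h1, h2))"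
    if "t \<in> carrier (C2 H I)" "h1 \<in> carrier H" "h2 \<in> carrier H" "h3 \<in> carrier H" for h1 h2 h3
    using that by (simp add: C_simps I.inv_eq_quot I.quot_simps I.m_ac)
  \<comment> \<open>\<open>RH_circ\<close> splits the index of \<open>mu\<close> in
    \<open>Phi2\<close>; this is the origin of the product of \<open>RH h1\<close> and
    \<open>RH h2\<close> on the right.\<close>
  have 2: "partial1 H RH I mu g (h1, h2)
           \<^bold>+ \<^bold>- RI (mu (RH h2) (mu h2 (g h1) \<^bold>+ \<^bold>- g h1))
           \<^bold>+ \<^bold>- Phi2 H RH I RI mu t (h1, h2) = \<^bold>0 \<longleftrightarrow>
      g h2 \<^bold>+ mu (RH h2) (g h1) \<^bold>+ RI (mu (RH h2) (g h1))
        \<^bold>+ RI (mu (RH h1 \<cdot> RH h2) (t (h1 \<cdot> RH h1, h2 \<cdot> inv\<^bsub>H\<^esub> RH h1)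
            \<^bold>+ mu (h2 \<cdot> inv\<^bsub>H\<^esub> RH h1) (t (h1, RH h1)) \<^bold>+ t (h2, inv\<^bsub>H\<^esub> RH h1)))
        = g (rb_circ H RH h1 h2) \<^bold>+ RI (mu (h2 \<cdot> RH h2) (g h1)) \<^bold>+ t (RH h1, RH h2)
        \<^bold>+ RI (mu (RH h1 \<cdot> RH h2) (t (RH h1, inv\<^bsub>H\<^esub> RH h1)))"
    if "t \<in> carrier (C2 H I)" "g \<in> carrier (C1 H I)" "h1 \<in> carrier H" "h2 \<in> carrier H" for h1 h2
    using that
    by (simp add: partial1_def Phi2_def C_simps I.inv_eq_quot I.quot_simps quot_hom I.m_ac H.m_assoc)
  show ?thesis
    by (simp add: Z2_def 1 2 cong: conj_cong ball_cong)
qed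

lemma E_simps [simp]:
  "carrier (mid (E (t, g))) = carrier H \<times> carrier I"
  "(h1, y1) \<otimes>\<^bsub>mid (E (t, g))\<^esub> (h2, y2) = (h1 \<cdot> h2, mu h2 y1 \<^bold>+ y2 \<^bold>+ t (h1, h2))"
  "\<one>\<^bsub>mid (E (t, g))\<^esub> = (\<one>\<^bsub>H\<^esub>, \<^bold>0)"
  "rbop (E (t, g)) (h, y) = (RH h, \<^bold>- g h \<^bold>+ RI (mu (RH h) y))"
  "incl (E (t, g)) y = (\<one>\<^bsub>H\<^esub>, y)"
  "proj (E (t, g)) = fst"
  by (simp_all add: ext_of_cocycle_def)

section \<open>Cocycle conditions as group and Rota-Baxter axioms\<close>

context
  fixes t g
  assumes t: "t \<in> carrier (C2 H I)" and g: "g \<in> carrier (C1 H I)"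
begin

text \<open>In the associative law the terms coming from the I-coordinates agree on both sides
  because \<open>mu\<close> is an action; only the values of \<open>t\<close> remain. Triples with
  zero I-coordinates therefore already test it.\<close>

lemma group_E_iff:
  "group (mid (E (t, g))) \<longleftrightarrow>
     (\<forall>h1\<in>carrier H. \<forall>h2\<in>carrier H. \<forall>h3\<in>carrier H.
        t (h1, h2 \<cdot> h3) \<^bold>+ t (h2, h3) = t (h1 \<cdot> h2, h3) \<^bold>+ mu h3 (t (h1, h2)))" (is "_ \<longleftrightarrow> ?C")
proof
  assume "group (mid (E (t, g)))"
  then interpret G: group "mid (E (t, g))" .
  show ?C
  proof safe
    fix h1 h2 h3 assume h: "h1 \<in> carrier H" "h2 \<in> carrier H" "h3 \<in> carrier H"
    show "t (h1, h2 \<cdot> h3) \<^bold>+ t (h2, h3) = t (h1 \<cdot> h2, h3) \<^bold>+ mu h3 (t (h1, h2))"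
      using G.m_assoc[of "(h1, \<^bold>0)" "(h2, \<^bold>0)" "(h3, \<^bold>0)"] h t by (simp add: C_simps I.m_ac)
  qed
next
  assume C: ?C
  show "group (mid (E (t, g)))"
  proof (rule groupI)
    fix x y z
    assume "x \<in> carrier (mid (E (t, g)))" "y \<in> carrier (mid (E (t, g)))" "z \<in> carrier (mid (E (t, g)))"
    then obtain h1 y1 h2 y2 h3 y3 where
      [simp]: "x = (h1, y1)" "y = (h2, y2)" "z = (h3, y3)" and
      h [simp]: "h1 \<in> carrier H" "h2 \<in> carrier H" "h3 \<in> carrier H"
      and y [simp]: "y1 \<in> carrier I" "y2 \<in> carrier I" "y3 \<in> carrier I"
      by auto
    have [simp]: "t (h1, h2) \<in> carrier I" "t (h2, h3) \<in> carrier I" "t (h1 \<cdot> h2, h3) \<in> carrier I"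
      "t (h1, h2 \<cdot> h3) \<in> carrier I"
      using t by (simp_all add: C_simps)
    have "mu h3 (mu h2 y1 \<^bold>+ y2 \<^bold>+ t (h1, h2)) \<^bold>+ y3 \<^bold>+ t (h1 \<cdot> h2, h3)
        = mu (h2 \<cdot> h3) y1 \<^bold>+ mu h3 y2 \<^bold>+ y3 \<^bold>+ (t (h1 \<cdot> h2, h3) \<^bold>+ mu h3 (t (h1, h2)))"
      by (simp add: I.m_ac)
    also have "\<dots> = mu (h2 \<cdot> h3) y1 \<^bold>+ mu h3 y2 \<^bold>+ y3 \<^bold>+ (t (h1, h2 \<cdot> h3) \<^bold>+ t (h2, h3))"
      using C by simp
    also have "\<dots> = mu (h2 \<cdot> h3) y1 \<^bold>+ (mu h3 y2 \<^bold>+ y3 \<^bold>+ t (h2, h3)) \<^bold>+ t (h1, h2 \<cdot> h3)"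
      by (simp add: I.m_ac)
    finally show "x \<otimes>\<^bsub>mid (E (t, g))\<^esub> y \<otimes>\<^bsub>mid (E (t, g))\<^esub> z = x \<otimes>\<^bsub>mid (E (t, g))\<^esub> (y \<otimes>\<^bsub>mid (E (t, g))\<^esub> z)"
      by (simp add: H.m_assoc)
  next
    fix x assume "x \<in> carrier (mid (E (t, g)))"
    then obtain h y where [simp]: "x = (h, y)" "h \<in> carrier H" "y \<in> carrier I" by auto
    have [simp]: "t (inv\<^bsub>H\<^esub> h, h) \<in> carrier I" using t by (simp add: C_simps)
    show "\<exists>y\<in>carrier (mid (E (t, g))). y \<otimes>\<^bsub>mid (E (t, g))\<^esub> x = \<one>\<^bsub>mid (E (t, g))\<^esub>"
      \<comment> \<open>The second coordinate z solves \<open>mu h z + y + t (inv h, h) = 0\<close>,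
        written additively; \<open>mu (inv h)\<close> undoes \<open>mu h\<close>.\<close>
      by (rule bexI[of _ "(inv\<^bsub>H\<^esub> h, mu (inv\<^bsub>H\<^esub> h) (\<^bold>- (y \<^bold>+ t (inv\<^bsub>H\<^esub> h, h))))"])
        (simp_all add: I.m_assoc)
  qed (use t in \<open>auto simp: C_simps\<close>)
qed

text \<open>Solving for the inverse on the right yields the value \<open>t (a, inv a)\<close>, the
  one that occurs in \<open>Phi2\<close>; on the left it would be
  \<open>t (inv a, a)\<close>.\<close>

lemma inv_E:
  assumes "group (mid (E (t, g)))" "a \<in> carrier H" "z \<in> carrier I"
  shows "inv\<^bsub>mid (E (t, g))\<^esub> (a, z) = (inv\<^bsub>H\<^esub> a, \<^bold>- (mu (inv\<^bsub>H\<^esub> a) z \<^bold>+ t (a, inv\<^bsub>H\<^esub> a)))"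
proof -
  interpret G: group "mid (E (t, g))" by fact
  have [simp]: "t (a, inv\<^bsub>H\<^esub> a) \<in> carrier I" using t assms by (simp add: C_simps)
  let ?w = "(inv\<^bsub>H\<^esub> a, \<^bold>- (mu (inv\<^bsub>H\<^esub> a) z \<^bold>+ t (a, inv\<^bsub>H\<^esub> a)))"
  have "(a, z) \<otimes>\<^bsub>mid (E (t, g))\<^esub> ?w = \<one>\<^bsub>mid (E (t, g))\<^esub>"
    using assms by (simp add: I.inv_eq_quot I.quot_simps I.m_ac)
  then have "inv\<^bsub>mid (E (t, g))\<^esub> ?w = (a, z)"
    using assms by (intro G.inv_equality) auto
  then show ?thesis
    using assms G.inv_inv[of ?w] by simp
qed

text \<open>Both sides of the Rota-Baxter identity split into a part with the cochains and a part
  with the I-coordinates. The latter parts agree by the module condition \<open>mu_rb\<close>, which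
  leaves a condition on \<open>h1\<close> and \<open>h2\<close> alone.\<close>

lemma rb_E_iff:
  assumes "group (mid (E (t, g)))"
  shows "rota_baxter_group (mid (E (t, g))) (rbop (E (t, g))) \<longleftrightarrow>
     (\<forall>h1\<in>carrier H. \<forall>h2\<in>carrier H.
        g h2 \<^bold>+ mu (RH h2) (g h1) \<^bold>+ RI (mu (RH h2) (g h1))
        \<^bold>+ RI (mu (RH h1 \<cdot> RH h2) (t (h1 \<cdot> RH h1, h2 \<cdot> inv\<^bsub>H\<^esub> RH h1)
            \<^bold>+ mu (h2 \<cdot> inv\<^bsub>H\<^esub> RH h1) (t (h1, RH h1)) \<^bold>+ t (h2, inv\<^bsub>H\<^esub> RH h1)))
        = g (rb_circ H RH h1 h2) \<^bold>+ RI (mu (h2 \<cdot> RH h2) (g h1)) \<^bold>+ t (RH h1, RH h2)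
        \<^bold>+ RI (mu (RH h1 \<cdot> RH h2) (t (RH h1, inv\<^bsub>H\<^esub> RH h1))))" (is "_ \<longleftrightarrow> (\<forall>h1\<in>_. \<forall>h2\<in>_. ?D h1 h2)")
proof -
  interpret G: group "mid (E (t, g))" by fact
  let ?R = "rbop (E (t, g))"
  define rb where "rb x y \<longleftrightarrow> ?R x \<otimes>\<^bsub>mid (E (t, g))\<^esub> ?R y
      = ?R (x \<otimes>\<^bsub>mid (E (t, g))\<^esub> ?R x \<otimes>\<^bsub>mid (E (t, g))\<^esub> y \<otimes>\<^bsub>mid (E (t, g))\<^esub> inv\<^bsub>mid (E (t, g))\<^esub> ?R x)" for x y
  have key: "rb (h1, y1) (h2, y2) \<longleftrightarrow> ?D h1 h2"
    if [simp]: "h1 \<in> carrier H" "h2 \<in> carrier H" "y1 \<in> carrier I" "y2 \<in> carrier I" for h1 y1 h2 y2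
  proof -
    define a where "a = RH h1"
    define b where "b = RH h2"
    have [simp]: "a \<in> carrier H" "b \<in> carrier H" by (simp_all add: a_def b_def)
    note [simp] = a_def[symmetric] b_def[symmetric] H.m_assoc
    note [simp] = C1_closed[OF g] C2_closed[OF t]
    define c where "c = rb_circ H RH h1 h2"
    have [simp]: "c \<in> carrier H" "RH c = a \<cdot> b" by (simp_all add: c_def)
    have c: "h1 \<cdot> (a \<cdot> (h2 \<cdot> inv\<^bsub>H\<^esub> a)) = c" by (simp add: c_def rb_circ_def)
    note [simp] = c_def[symmetric]
    have [simp]: "inv\<^bsub>H\<^esub> a \<cdot> (a \<cdot> x) = x" if "x \<in> carrier H" for x
      using that H.m_assoc[of "inv\<^bsub>H\<^esub> a" a x] by (simp del: H.m_assoc)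
    define u where "u = mu a y1"
    have [simp]: "u \<in> carrier I" by (simp add: u_def)
    note [simp] = u_def[symmetric]
    \<comment> \<open>\<open>L\<close> and \<open>S\<close> collect the terms in \<open>g\<close>
      and \<open>t\<close>, on the left side and in the argument of the outer operator on the right;
      \<open>w\<close> and \<open>V\<close> are the corresponding terms in \<open>y1\<close> and
      \<open>y2\<close>.\<close>
    define L where "L = mu b (\<^bold>- g h1) \<^bold>+ \<^bold>- g h2 \<^bold>+ t (a, b)"
    define S where "S = mu (h2 \<cdot> inv\<^bsub>H\<^esub> a) (\<^bold>- g h1 \<^bold>+ t (h1, a)) \<^bold>+ mu (inv\<^bsub>H\<^esub> a) (g h1)
        \<^bold>+ \<^bold>- t (a, inv\<^bsub>H\<^esub> a) \<^bold>+ t (h2, inv\<^bsub>H\<^esub> a) \<^bold>+ t (h1 \<cdot> a, h2 \<cdot> inv\<^bsub>H\<^esub> a)"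
    define w where "w = mu b (RI u) \<^bold>+ RI (mu b y2)"
    have [simp]: "L \<in> carrier I" "S \<in> carrier I" "w \<in> carrier I" by (simp_all add: L_def S_def w_def)
    define V where "V = mu (h2 \<cdot> inv\<^bsub>H\<^esub> a) (u \<^bold>+ RI u) \<^bold>+ mu (inv\<^bsub>H\<^esub> a) y2 \<^bold>+ \<^bold>- mu (inv\<^bsub>H\<^esub> a) (RI u)"
    have [simp]: "V \<in> carrier I" by (simp add: V_def)
    \<comment> \<open>Under \<open>mu\<close> the factors \<open>a\<close> and its inverse cancel;
      what remains is the module condition at \<open>h2\<close> and \<open>u\<close>.\<close>
    have "RI (mu (a \<cdot> b) V) = RI (mu (h2 \<cdot> b) (u \<^bold>+ RI u) \<^bold>+ \<^bold>- mu b (RI u)) \<^bold>+ RI (mu b y2)"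
      by (simp add: V_def I.m_ac)
    also have "\<dots> = w"
      using mu_rb[of h2 u] by (simp add: w_def)
    finally have V: "RI (mu (a \<cdot> b) V) = w" .
    have "?R (h1, y1) \<otimes>\<^bsub>mid (E (t, g))\<^esub> ?R (h2, y2) = (a \<cdot> b, L \<^bold>+ w)"
      by (simp add: L_def w_def I.m_ac)
    moreover have "(h1, y1) \<otimes>\<^bsub>mid (E (t, g))\<^esub> ?R (h1, y1) \<otimes>\<^bsub>mid (E (t, g))\<^esub> (h2, y2)
        \<otimes>\<^bsub>mid (E (t, g))\<^esub> inv\<^bsub>mid (E (t, g))\<^esub> ?R (h1, y1) = (c, S \<^bold>+ V)"
    proof -
      have R: "?R (h1, y1) = (a, \<^bold>- g h1 \<^bold>+ RI u)" by simp
      \<comment> \<open>This bracketing produces exactly the values of \<open>t\<close> in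
        \<open>Phi2\<close>, one for each of the three products; associativity then gives the
        left-nested form.\<close>
      have "(h1, y1) \<otimes>\<^bsub>mid (E (t, g))\<^esub> ?R (h1, y1) \<otimes>\<^bsub>mid (E (t, g))\<^esub>
          ((h2, y2) \<otimes>\<^bsub>mid (E (t, g))\<^esub> inv\<^bsub>mid (E (t, g))\<^esub> ?R (h1, y1)) = (c, S \<^bold>+ V)"
        unfolding R by (subst inv_E[OF assms])
          (simp_all add: c S_def V_def I.inv_eq_quot I.quot_simps quot_hom I.m_ac)
      moreover have "(h1, y1) \<in> carrier (mid (E (t, g)))" "(h2, y2) \<in> carrier (mid (E (t, g)))"
        "?R (h1, y1) \<in> carrier (mid (E (t, g)))"
        by simp_all
      ultimately show ?thesis
        by (simp only: G.m_assoc G.m_closed G.inv_closed)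
    qed
    ultimately have "rb (h1, y1) (h2, y2) \<longleftrightarrow> L \<^bold>+ w = \<^bold>- g c \<^bold>+ RI (mu (a \<cdot> b) S) \<^bold>+ w"
      by (simp add: rb_def V I.m_assoc)
    also have "\<dots> \<longleftrightarrow> \<^bold>- g c \<^bold>+ RI (mu (a \<cdot> b) S) = L"
      by auto
    also have "\<dots> \<longleftrightarrow> ?D h1 h2"
      by (simp add: L_def S_def I.inv_eq_quot I.quot_simps quot_hom I.m_ac)
    finally show ?thesis .
  qed
  have "rota_baxter_group (mid (E (t, g))) ?R \<longleftrightarrow>
     (\<forall>x\<in>carrier (mid (E (t, g))). \<forall>y\<in>carrier (mid (E (t, g))). rb x y)"
    using g by (auto simp: rota_baxter_group_def rota_baxter_group_axioms_def rb_def C_simps G.is_group)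
  also have "\<dots> \<longleftrightarrow> (\<forall>h1\<in>carrier H. \<forall>h2\<in>carrier H. ?D h1 h2)"
    \<comment> \<open>A second coordinate must exist for the condition on pairs to say anything
      about \<open>h1\<close> and \<open>h2\<close>.\<close>
    using key I.one_closed unfolding E_simps by blast
  finally show ?thesis .
qed

lemma Z2_iff: "(t, g) \<in> carrier Z \<longleftrightarrow> rota_baxter_group (mid (E (t, g))) (rbop (E (t, g)))"
  unfolding Z2_carrier using t g group_E_iff rb_E_iff rota_baxter_group.axioms(1) by blast

end

end

text \<open>An injective homomorphism that commutes with the operators reflects identities between
  terms.\<close>

lemma rota_baxter_pullback:
  assumes "rota_baxter_group G R" "group K" "f \<in> hom K G" "inj_on f (carrier K)"
    and Q: "Q \<in> carrier K \<rightarrow> carrier K" "\<And>x. x \<in> carrier K \<Longrightarrow> f (Q x) = R (f x)"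
  shows "rota_baxter_group K Q"
proof -
  interpret G: rota_baxter_group G R by fact
  interpret K: group K by fact
  interpret f: group_hom K G f using assms(3) by unfold_locales
  show ?thesis
  proof unfold_locales
    fix x y assume xy [simp]: "x \<in> carrier K" "y \<in> carrier K"
    have [simp]: "Q z \<in> carrier K" if "z \<in> carrier K" for z using Q(1) that by auto
    have "f (Q x \<otimes>\<^bsub>K\<^esub> Q y) = f (Q (x \<otimes>\<^bsub>K\<^esub> Q x \<otimes>\<^bsub>K\<^esub> y \<otimes>\<^bsub>K\<^esub> inv\<^bsub>K\<^esub> Q x))"
      using G.rota_baxter[of "f x" "f y"] by (simp add: Q(2))
    then show "Q x \<otimes>\<^bsub>K\<^esub> Q y = Q (x \<otimes>\<^bsub>K\<^esub> Q x \<otimes>\<^bsub>K\<^esub> y \<otimes>\<^bsub>K\<^esub> inv\<^bsub>K\<^esub> Q x)"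
      by (rule inj_onD[OF assms(4)]) simp_all
  qed (fact Q(1))
qed

section \<open>Equivalence of extensions\<close>

lemma rb_extensionD:
  assumes "rb_extension H RH I RI X"
  shows "group (mid X)" "group H" "group I"
    and "rota_baxter_group (mid X) (rbop X)"
    and "incl X \<in> hom I (mid X)" "proj X \<in> hom (mid X) H"
    and "y \<in> carrier I \<Longrightarrow> incl X y \<in> carrier (mid X)"
    and "x \<in> carrier (mid X) \<Longrightarrow> proj X x \<in> carrier H"
    and "x \<in> carrier (mid X) \<Longrightarrow> rbop X x \<in> carrier (mid X)"
    and "y \<in> carrier I \<Longrightarrow> incl X (RI y) = rbop X (incl X y)"
    and "x \<in> carrier (mid X) \<Longrightarrow> proj X (rbop X x) = RH (proj X x)"
    and "inj_on (incl X) (carrier I)"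
    and "incl X ` carrier I = kernel (mid X) H (proj X)"
    and "proj X ` carrier (mid X) = carrier H"
  using assms
  by (auto simp: rb_extension_def rb_hom_def rota_baxter_group_def rota_baxter_group_axioms_def hom_def)

lemma ext_equiv_refl: "rb_extension H RH I RI X \<Longrightarrow> ext_equiv I X X"
  unfolding ext_equiv_def
  by (rule bexI[of _ "\<lambda>x. x"]) (auto simp: rb_hom_def iso_def hom_def bij_betw_def)

lemma ext_equiv_sym:
  assumes X: "rb_extension H RH I RI X" and Y: "rb_extension H RH I RI Y" and "ext_equiv I X Y"
  shows "ext_equiv I Y X"
proof -
  obtain f where f: "f \<in> iso (mid X) (mid Y)" "f \<in> rb_hom (mid X) (rbop X) (mid Y) (rbop Y)"
    "\<And>y. y \<in> carrier I \<Longrightarrow> f (incl X y) = incl Y y"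
    "\<And>x. x \<in> carrier (mid X) \<Longrightarrow> proj Y (f x) = proj X x"
    using assms(3) by (auto simp: ext_equiv_def)
  let ?g = "inv_into (carrier (mid X)) f"
  have inj: "inj_on f (carrier (mid X))" and im: "f ` carrier (mid X) = carrier (mid Y)"
    using f(1) by (auto simp: iso_def bij_betw_def)
  have g: "?g \<in> iso (mid Y) (mid X)"
    by (rule group.iso_set_sym[OF rb_extensionD(1)[OF X] f(1)])
  have fR: "f (rbop X x) = rbop Y (f x)" if "x \<in> carrier (mid X)" for x
    using f(2) that by (simp add: rb_hom_def)
  have gf: "?g (f x) = x" if "x \<in> carrier (mid X)" for x
    using inj that by simp
  have Ex: "\<exists>x\<in>carrier (mid X). y = f x" if "y \<in> carrier (mid Y)" for y
    using that im by auto
  show ?thesis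
    unfolding ext_equiv_def
  proof (intro bexI[of _ ?g] conjI ballI IntI g)
    show "?g \<in> rb_hom (mid Y) (rbop Y) (mid X) (rbop X)"
      using g Ex by (force simp: rb_hom_def iso_def gf fR[symmetric] rb_extensionD(9)[OF X])
    show "?g (incl Y y) = incl X y" if "y \<in> carrier I" for y
      using that by (simp add: f(3)[symmetric] gf rb_extensionD(7)[OF X])
    show "proj X (?g y) = proj Y y" if "y \<in> carrier (mid Y)" for y
      using Ex[OF that] by (auto simp: gf f(4))
  qed
qed

lemma ext_equiv_trans:
  assumes "ext_equiv I X Y" "ext_equiv I Y W"
  shows "ext_equiv I X W"
proof -
  obtain f where f: "f \<in> iso (mid X) (mid Y)" "f \<in> rb_hom (mid X) (rbop X) (mid Y) (rbop Y)"
    "\<forall>y\<in>carrier I. f (incl X y) = incl Y y" "\<forall>x\<in>carrier (mid X). proj Y (f x) = proj X x"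
    using assms(1) by (auto simp: ext_equiv_def)
  obtain g where g: "g \<in> iso (mid Y) (mid W)" "g \<in> rb_hom (mid Y) (rbop Y) (mid W) (rbop W)"
    "\<forall>y\<in>carrier I. g (incl Y y) = incl W y" "\<forall>x\<in>carrier (mid Y). proj W (g x) = proj Y x"
    using assms(2) by (auto simp: ext_equiv_def)
  show ?thesis
    unfolding ext_equiv_def
  proof (rule bexI[of _ "g \<circ> f"], intro conjI ballI IntI)
    show "g \<circ> f \<in> iso (mid X) (mid W) \<inter> rb_hom (mid X) (rbop X) (mid W) (rbop W)"
      using f(1,2) g(1,2)
      by (auto simp: rb_hom_def iso_def hom_compose intro: bij_betw_trans dest: hom_in_carrier)
  qed (use f g in \<open>auto simp: iso_def dest: hom_in_carrier\<close>)
qed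

lemma ext_class_cong:
  assumes "rb_extension H RH I RI X" "rb_extension H RH I RI Y" "ext_equiv I X Y"
  shows "ext_class H RH I RI X = ext_class H RH I RI Y"
  using ext_equiv_trans[OF assms(3)] ext_equiv_trans[OF ext_equiv_sym[OF assms]]
  unfolding ext_class_def by blast

text \<open>The converse direction uses that \<open>Y\<close> is a member of its own class, which is
  why its middle group must live on \<open>'h \<times> 'i\<close> while that of \<open>X\<close> is
  arbitrary.\<close>

lemma ext_class_eq_iff:
  fixes Y :: "('h, 'i, 'h \<times> 'i) rb_ext"
  assumes "rb_extension H RH I RI X" "rb_extension H RH I RI Y"
  shows "ext_class H RH I RI X = ext_class H RH I RI Y \<longleftrightarrow> ext_equiv I X Y"
proof
  assume "ext_class H RH I RI X = ext_class H RH I RI Y"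
  moreover have "Y \<in> ext_class H RH I RI Y"
    using assms(2) by (simp add: ext_class_def ext_equiv_refl)
  ultimately show "ext_equiv I X Y" by (auto simp: ext_class_def)
qed (rule ext_class_cong[OF assms])

context rb_module
begin

section \<open>Cocycles and coboundaries\<close>

lemma Z_mult:
  "(t, g) \<otimes>\<^bsub>Z\<^esub> (t', g') =
     (\<lambda>x\<in>carrier H \<times> carrier H. t x \<^bold>+ t' x, \<lambda>h\<in>carrier H. g h \<^bold>+ g' h)"
  by (simp add: Z2_def C1_def C2_def)

lemma Z_one: "\<one>\<^bsub>Z\<^esub> = (\<lambda>x\<in>carrier H \<times> carrier H. \<^bold>0, \<lambda>h\<in>carrier H. \<^bold>0)"
  by (simp add: Z2_def C1_def C2_def DirProd_def)

lemma C1_carrier: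
  "g \<in> carrier (C1 H I) \<longleftrightarrow> g \<in> carrier H \<rightarrow>\<^sub>E carrier I \<and> g \<one>\<^bsub>H\<^esub> = \<^bold>0"
  by (simp add: C1_def)

lemma C2_carrier:
  "t \<in> carrier (C2 H I) \<longleftrightarrow> t \<in> carrier H \<times> carrier H \<rightarrow>\<^sub>E carrier I \<and>
     (\<forall>h\<in>carrier H. t (h, \<one>\<^bsub>H\<^esub>) = \<^bold>0 \<and> t (\<one>\<^bsub>H\<^esub>, h) = \<^bold>0)"
  by (simp add: C2_def)

lemma Z_closed:
  assumes "p \<in> carrier Z" "q \<in> carrier Z"
  shows "p \<otimes>\<^bsub>Z\<^esub> q \<in> carrier Z"
proof -
  obtain t g t' g' where [simp]: "p = (t, g)" "q = (t', g')" by (cases p, cases q)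
  note p = assms[simplified, unfolded Z2_carrier]
  have [simp]: "g h \<in> carrier I" "g' h \<in> carrier I" if "h \<in> carrier H" for h
    using p that by (auto intro: C1_closed)
  have [simp]: "t (h, k) \<in> carrier I" "t' (h, k) \<in> carrier I" if "h \<in> carrier H" "k \<in> carrier H" for h k
    using p that by (auto intro: C2_closed)
  show ?thesis
    apply (simp add: Z_mult Z2_carrier)
    apply (intro conjI ballI)
    subgoal using p by (auto simp: C2_carrier)
    subgoal using p by (auto simp: C1_carrier)
    subgoal premises h for h1 h2 h3
    proof -
      have "t (h1, h2 \<cdot> h3) \<^bold>+ t (h2, h3) \<^bold>+ (t' (h1, h2 \<cdot> h3) \<^bold>+ t' (h2, h3)) =
        t (h1 \<cdot> h2, h3) \<^bold>+ mu h3 (t (h1, h2)) \<^bold>+ (t' (h1 \<cdot> h2, h3) \<^bold>+ mu h3 (t' (h1, h2)))"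
        using p h by simp
      then show ?thesis using h by (simp add: I.m_ac)
    qed
    subgoal premises h for h1 h2
    proof -
      \<comment> \<open>The two sides of the second cocycle condition as functions of the cochains.
        Both are additive, because \<open>mu\<close> and \<open>RI\<close> are homomorphisms, so the
        equations of the two summands can be added.\<close>
      define L where "L t g = g h2 \<^bold>+ mu (RH h2) (g h1) \<^bold>+ RI (mu (RH h2) (g h1))
        \<^bold>+ RI (mu (RH h1 \<cdot> RH h2) (t (h1 \<cdot> RH h1, h2 \<cdot> inv\<^bsub>H\<^esub> RH h1)
            \<^bold>+ mu (h2 \<cdot> inv\<^bsub>H\<^esub> RH h1) (t (h1, RH h1)) \<^bold>+ t (h2, inv\<^bsub>H\<^esub> RH h1)))" for t g
      define R where "R t g = g (rb_circ H RH h1 h2) \<^bold>+ RI (mu (h2 \<cdot> RH h2) (g h1)) \<^bold>+ t (RH h1, RH h2)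
        \<^bold>+ RI (mu (RH h1 \<cdot> RH h2) (t (RH h1, inv\<^bsub>H\<^esub> RH h1)))" for t g
      have "L t g \<^bold>+ L t' g' = R t g \<^bold>+ R t' g'"
        using p h by (simp add: L_def R_def)
      then show ?thesis using h by (simp add: L_def R_def I.m_ac)
    qed
    done
qed

lemma Z_uminus:
  assumes "(t, g) \<in> carrier Z"
  shows "(\<lambda>x\<in>carrier H \<times> carrier H. \<^bold>- t x, \<lambda>h\<in>carrier H. \<^bold>- g h) \<in> carrier Z"
proof -
  note p = assms[unfolded Z2_carrier]
  have [simp]: "g h \<in> carrier I" if "h \<in> carrier H" for h
    using p that by (auto intro: C1_closed)
  have [simp]: "t (h, k) \<in> carrier I" if "h \<in> carrier H" "k \<in> carrier H" for h k
    using p that by (auto intro: C2_closed)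
  show ?thesis
    apply (simp add: Z2_carrier)
    apply (intro conjI ballI)
    subgoal using p by (auto simp: C2_carrier)
    subgoal using p by (auto simp: C1_carrier)
    subgoal premises h for h1 h2 h3
    proof -
      have "\<^bold>- (t (h1, h2 \<cdot> h3) \<^bold>+ t (h2, h3)) = \<^bold>- (t (h1 \<cdot> h2, h3) \<^bold>+ mu h3 (t (h1, h2)))"
        using p h by simp
      then show ?thesis using h by (simp add: I.inv_mult)
    qed
    subgoal premises h for h1 h2
    proof -
      define L where "L t g = g h2 \<^bold>+ mu (RH h2) (g h1) \<^bold>+ RI (mu (RH h2) (g h1))
        \<^bold>+ RI (mu (RH h1 \<cdot> RH h2) (t (h1 \<cdot> RH h1, h2 \<cdot> inv\<^bsub>H\<^esub> RH h1)
            \<^bold>+ mu (h2 \<cdot> inv\<^bsub>H\<^esub> RH h1) (t (h1, RH h1)) \<^bold>+ t (h2, inv\<^bsub>H\<^esub> RH h1)))" for t g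
      define R where "R t g = g (rb_circ H RH h1 h2) \<^bold>+ RI (mu (h2 \<cdot> RH h2) (g h1)) \<^bold>+ t (RH h1, RH h2)
        \<^bold>+ RI (mu (RH h1 \<cdot> RH h2) (t (RH h1, inv\<^bsub>H\<^esub> RH h1)))" for t g
      have "\<^bold>- L t g = \<^bold>- R t g"
        using p h by (simp add: L_def R_def)
      then show ?thesis using h by (simp add: L_def R_def I.inv_mult)
    qed
    done
qed

lemma C_of_Z: "(t, g) \<in> carrier Z \<Longrightarrow> t \<in> carrier (C2 H I) \<and> g \<in> carrier (C1 H I)"
  by (simp add: Z2_carrier)

lemma comm_group_Z: "comm_group Z"
proof (rule comm_groupI)
  show "\<one>\<^bsub>Z\<^esub> \<in> carrier Z"
    by (simp add: Z_one Z2_carrier C1_carrier C2_carrier)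
next
  fix p assume "p \<in> carrier Z"
  \<comment> \<open>Adding zero restricts both components to their domains; extensionality of
    cochains makes this the same pair again.\<close>
  then show "\<one>\<^bsub>Z\<^esub> \<otimes>\<^bsub>Z\<^esub> p = p"
    by (cases p) (force dest!: C_of_Z simp: Z_one Z_mult C1_carrier C2_carrier PiE_def
        extensional_def restrict_def Pi_def)
  obtain t g where p: "p = (t, g)" by (cases p)
  show "\<exists>q\<in>carrier Z. q \<otimes>\<^bsub>Z\<^esub> p = \<one>\<^bsub>Z\<^esub>"
    using \<open>p \<in> carrier Z\<close> unfolding p
    by (intro bexI[OF _ Z_uminus]) (auto dest!: C_of_Z simp: Z_one Z_mult C_simps intro!: restrict_ext)
qed (auto simp: Z_closed Z_mult C_simps I.m_ac dest!: C_of_Z intro!: restrict_ext)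

text \<open>The coboundary as a map on 1-cochains: \<open>B\<close> is its image, and it is a
  subgroup because this map is a homomorphism into \<open>Z\<close>.\<close>

definition cob :: "('h \<Rightarrow> 'i) \<Rightarrow> ('h \<times> 'h \<Rightarrow> 'i) \<times> ('h \<Rightarrow> 'i)" where
  "cob \<theta> = (delta1 H I mu \<theta>, \<lambda>h\<in>carrier H. \<^bold>- Phi1 H RH I RI mu \<theta> h)"

lemma B2_eq: "B = cob ` carrier (C1 H I)"
  by (auto simp: B2_def cob_def)

text \<open>Replacing a section \<open>s\<close> by \<open>h \<mapsto> s h \<theta>(h)\<close> changes its cocycle by \<open>cob \<theta>\<close>.\<close>

definition shift :: "('h \<Rightarrow> 'i) \<Rightarrow> 'h \<times> 'i \<Rightarrow> 'h \<times> 'i" where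
  "shift \<theta> = (\<lambda>(h, y). (h, \<theta> h \<^bold>+ y))"

context
  fixes \<theta> assumes \<theta>: "\<theta> \<in> carrier (C1 H I)"
begin

lemma shift_bij: "bij_betw (shift \<theta>) (carrier H \<times> carrier I) (carrier H \<times> carrier I)"
  by (rule bij_betw_byWitness[where f' = "\<lambda>(h, y). (h, \<^bold>- \<theta> h \<^bold>+ y)"])
    (use \<theta> in \<open>auto simp: shift_def C_simps I.m_assoc[symmetric]\<close>)

lemma shift_mult:
  assumes "t \<in> carrier (C2 H I)" "x \<in> carrier H \<times> carrier I" "y \<in> carrier H \<times> carrier I"
  shows "shift \<theta> (x \<otimes>\<^bsub>mid (E ((t, g) \<otimes>\<^bsub>Z\<^esub> cob \<theta>))\<^esub> y) =
    shift \<theta> x \<otimes>\<^bsub>mid (E (t, g))\<^esub> shift \<theta> y"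
  using assms \<theta>
  by (cases x; cases y) (auto simp: cob_def Z_mult shift_def delta1_def C_simps
      I.inv_eq_quot I.quot_simps I.m_ac)

text \<open>The minus sign of \<open>Phi1\<close> in \<open>cob\<close> meets the minus sign of
  \<open>g\<close> in the operator: \<theta> at \<open>RH h\<close> cancels and
  \<open>RI (mu (RH h) (\<theta> h))\<close> is left, as the operator after the shift
  requires.\<close>

lemma shift_rbop:
  assumes "g \<in> carrier (C1 H I)" "x \<in> carrier H \<times> carrier I"
  shows "shift \<theta> (rbop (E ((t, g) \<otimes>\<^bsub>Z\<^esub> cob \<theta>)) x) = rbop (E (t, g)) (shift \<theta> x)"
  using assms \<theta>
  by (cases x) (auto simp: cob_def Z_mult shift_def Phi1_def C_simps
      I.inv_eq_quot I.quot_simps I.m_ac)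

lemma cob_C: "delta1 H I mu \<theta> \<in> carrier (C2 H I)"
  "(\<lambda>h\<in>carrier H. \<^bold>- Phi1 H RH I RI mu \<theta> h) \<in> carrier (C1 H I)"
  using \<theta> by (auto simp: C2_carrier C1_carrier[of "restrict _ _"] delta1_def Phi1_def C_simps)

end

text \<open>The tool by which cocycles are recognised without calculation: the structure attached to
  the cochains inherits all axioms from \<open>G\<close>, and \<open>Z2_iff\<close> translates these
  back.\<close>

lemma pullback_in_Z2:
  assumes t: "t \<in> carrier (C2 H I)" and g: "g \<in> carrier (C1 H I)"
    and "rota_baxter_group G R"
    and inj: "inj_on f (carrier H \<times> carrier I)" and f: "f \<in> carrier H \<times> carrier I \<rightarrow> carrier G"
    and f_mult: "\<And>x y. x \<in> carrier H \<times> carrier I \<Longrightarrow> y \<in> carrier H \<times> carrier I \<Longrightarrow>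
      f (x \<otimes>\<^bsub>mid (E (t, g))\<^esub> y) = f x \<otimes>\<^bsub>G\<^esub> f y"
    and f_rbop: "\<And>x. x \<in> carrier H \<times> carrier I \<Longrightarrow> f (rbop (E (t, g)) x) = R (f x)"
  shows "(t, g) \<in> carrier Z"
proof -
  interpret G: rota_baxter_group G R by fact
  \<comment> \<open>Pulling back the operator identity presupposes a group, so associativity is
    transferred first, with only injectivity and multiplicativity of \<open>f\<close> at
    hand.\<close>
  have *: "group (mid (E (t, g)))"
    unfolding group_E_iff[OF t g]
  proof safe
    fix h1 h2 h3 assume [simp]: "h1 \<in> carrier H" "h2 \<in> carrier H" "h3 \<in> carrier H"
    let ?x = "(h1, \<^bold>0)" and ?y = "(h2, \<^bold>0)" and ?z = "(h3, \<^bold>0)"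
    let ?m = "monoid.mult (mid (E (t, g)))"
    have cl: "?m x y \<in> carrier H \<times> carrier I"
      if "x \<in> carrier H \<times> carrier I" "y \<in> carrier H \<times> carrier I" for x y
      using that t by (auto simp: C_simps)
    have fc: "f x \<in> carrier G" if "x \<in> carrier H \<times> carrier I" for x
      using f that by auto
    have "f (?m (?m ?x ?y) ?z) = f (?m ?x (?m ?y ?z))"
      by (simp add: f_mult cl fc G.m_assoc del: E_simps)
    then have "?m (?m ?x ?y) ?z = ?m ?x (?m ?y ?z)"
      by (rule inj_onD[OF inj]) (simp_all add: cl del: E_simps)
    then show "t (h1, h2 \<cdot> h3) \<^bold>+ t (h2, h3) = t (h1 \<cdot> h2, h3) \<^bold>+ mu h3 (t (h1, h2))"
      using t by (simp add: C_simps I.m_ac)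
  qed
  have "rota_baxter_group (mid (E (t, g))) (rbop (E (t, g)))"
    by (rule rota_baxter_pullback[OF assms(3) *, of f])
      (use f f_mult f_rbop inj g in \<open>auto simp: hom_def C_simps\<close>)
  then show ?thesis by (simp add: Z2_iff[OF t g])
qed

lemma one_Z_closed: "\<one>\<^bsub>Z\<^esub> \<in> carrier Z"
  by (rule monoid.one_closed[OF group.is_monoid[OF comm_group.axioms(2)[OF comm_group_Z]]])

text \<open>The shift by \<theta> carries the structure of \<open>cob \<theta>\<close> bijectively
  to that of the zero cocycle, the semidirect product.\<close>

lemma cob_in_Z:
  assumes \<theta>: "\<theta> \<in> carrier (C1 H I)"
  shows "cob \<theta> \<in> carrier Z"
proof -
  obtain t0 g0 where o: "\<one>\<^bsub>Z\<^esub> = (t0, g0)" by (metis surj_pair)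
  then have o': "t0 \<in> carrier (C2 H I)" "g0 \<in> carrier (C1 H I)"
    using one_Z_closed C_of_Z by metis+
  have eq: "(t0, g0) \<otimes>\<^bsub>Z\<^esub> cob \<theta> = cob \<theta>"
    using cob_C[OF \<theta>] unfolding o[symmetric] Z_one cob_def Z_mult
    by (auto simp: C1_carrier C2_carrier PiE_iff extensional_def restrict_def fun_eq_iff)
  note s = shift_mult[OF \<theta> o'(1), of _ _ g0] shift_rbop[OF \<theta> o'(2), of _ t0]
  have rb: "rota_baxter_group (mid (E (t0, g0))) (rbop (E (t0, g0)))"
    using Z2_iff[OF o'] one_Z_closed o by simp
  show ?thesis
    unfolding cob_def
    by (rule pullback_in_Z2[OF cob_C[OF \<theta>] rb, of "shift \<theta>"])
      (use shift_bij[OF \<theta>] bij_betw_imp_funcset[OF shift_bij[OF \<theta>]] s in \<open>auto simp: bij_betw_def simp flip: cob_def simp: eq simp del: E_simps(2,4)\<close>)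
qed

lemma C1_mult: "\<theta> \<otimes>\<^bsub>C1 H I\<^esub> \<theta>' = (\<lambda>h\<in>carrier H. \<theta> h \<^bold>+ \<theta>' h)"
  by (simp add: C1_def)

lemma group_C1: "group (C1 H I)"
proof (rule groupI)
  fix x assume "x \<in> carrier (C1 H I)"
  then show "\<exists>y\<in>carrier (C1 H I). y \<otimes>\<^bsub>C1 H I\<^esub> x = \<one>\<^bsub>C1 H I\<^esub>"
    by (intro bexI[of _ "\<lambda>h\<in>carrier H. \<^bold>- x h"])
      (auto simp: C1_def C1_carrier[of "restrict _ _"] PiE_iff intro!: restrict_ext)
qed (auto simp: C1_def PiE_iff I.m_assoc extensional_def restrict_def fun_eq_iff)

lemma cob_mult:
  assumes "\<theta> \<in> carrier (C1 H I)" "\<theta>' \<in> carrier (C1 H I)"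
  shows "cob (\<theta> \<otimes>\<^bsub>C1 H I\<^esub> \<theta>') = cob \<theta> \<otimes>\<^bsub>Z\<^esub> cob \<theta>'"
  using assms
  by (auto simp: cob_def Z_mult delta1_def Phi1_def C1_mult C_simps I.inv_eq_quot I.quot_simps I.m_ac
      intro!: restrict_ext)

lemma subgroup_B: "subgroup B Z"
proof -
  interpret Z: comm_group Z by (rule comm_group_Z)
  interpret C1: group "C1 H I" by (rule group_C1)
  interpret cob: group_hom "C1 H I" Z cob
    by unfold_locales (auto simp: hom_def cob_in_Z cob_mult)
  show ?thesis unfolding B2_eq by (rule cob.img_is_subgroup)
qed

lemma rb_extension_E:
  assumes p: "p \<in> carrier Z"
  shows "rb_extension H RH I RI (E p)"
proof -
  obtain t g where [simp]: "p = (t, g)" by (cases p)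
  have tg: "t \<in> carrier (C2 H I)" "g \<in> carrier (C1 H I)" using C_of_Z p by auto
  have "rota_baxter_group (mid (E p)) (rbop (E p))"
    using Z2_iff[OF tg] p by simp
  then show ?thesis
    using tg by (auto simp: rb_extension_def rb_hom_def hom_def kernel_def inj_on_def C_simps
        H.rota_baxter_group_axioms I.rota_baxter_group_axioms)
qed

text \<open>For every z the products of \<open>(h, z)\<close> with \<open>(1, mu h y)\<close> and of
  \<open>(1, y)\<close> with \<open>(h, z)\<close> coincide, so the choice of the section does not
  matter.\<close>

lemma has_action_E:
  assumes p: "p \<in> carrier Z"
  shows "has_action H I (E p) mu"
  unfolding has_action_def
proof (intro allI impI ballI)
  fix s h y assume s: "st_section H (E p) s" and [simp]: "h \<in> carrier H" "y \<in> carrier I"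
  obtain t g where [simp]: "p = (t, g)" by (cases p)
  have tg: "t \<in> carrier (C2 H I)" "g \<in> carrier (C1 H I)" using C_of_Z p by auto
  interpret G: group "mid (E (t, g))"
    using rb_extensionD(1)[OF rb_extension_E[OF p]] by simp
  have "s h \<in> carrier (mid (E p))" "proj (E p) (s h) = h"
    using s by (auto simp: st_section_def Pi_iff)
  then obtain z where sh: "s h = (h, z)" "z \<in> carrier I" by (cases "s h") auto
  have "s h \<otimes>\<^bsub>mid (E (t, g))\<^esub> incl (E p) (mu h y) = incl (E p) y \<otimes>\<^bsub>mid (E (t, g))\<^esub> s h"
    using sh tg by (simp add: C_simps I.m_ac)
  then show "incl (E p) (mu h y) =
      inv\<^bsub>mid (E p)\<^esub> (s h) \<otimes>\<^bsub>mid (E p)\<^esub> incl (E p) y \<otimes>\<^bsub>mid (E p)\<^esub> s h"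
    using G.eq_conj_iff[of "s h" "incl (E p) (mu h y)" "incl (E p) y"] sh by simp
qed

lemma ext_equiv_E_shift:
  assumes p: "p \<in> carrier Z" and \<theta>: "\<theta> \<in> carrier (C1 H I)"
  shows "ext_equiv I (E (p \<otimes>\<^bsub>Z\<^esub> cob \<theta>)) (E p)"
proof -
  obtain t g where [simp]: "p = (t, g)" by (cases p)
  have tg: "t \<in> carrier (C2 H I)" "g \<in> carrier (C1 H I)" using C_of_Z p by auto
  obtain t' g' where q: "(t, g) \<otimes>\<^bsub>Z\<^esub> cob \<theta> = (t', g')" by (metis surj_pair)
  have "shift \<theta> \<in> hom (mid (E (t', g'))) (mid (E (t, g)))"
    using shift_mult[OF \<theta> tg(1), where g = g] bij_betw_imp_funcset[OF shift_bij[OF \<theta>]]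
    by (auto simp: hom_def q simp del: E_simps(2))
  then show ?thesis
    unfolding ext_equiv_def
    using shift_rbop[OF \<theta> tg(2), where t = t] shift_bij[OF \<theta>]
    by (intro bexI[of _ "shift \<theta>"]) (use \<theta> in \<open>auto simp: q iso_def rb_hom_def shift_def C_simps\<close>)
qed

text \<open>An equivalence fixes I and lies over H, so it has to be the shift by the cochain
  \<theta> that it defines on the elements \<open>(h, 0)\<close>. Compatibility with products and
  operators of these elements gives the two components of the equation.\<close>

lemma ext_equiv_E_imp_cob:
  assumes p: "p \<in> carrier Z" and q: "q \<in> carrier Z" and "ext_equiv I (E q) (E p)"
  shows "\<exists>\<theta>\<in>carrier (C1 H I). q = p \<otimes>\<^bsub>Z\<^esub> cob \<theta>"
proof -
  obtain t g where [simp]: "p = (t, g)" by (cases p)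
  obtain t' g' where [simp]: "q = (t', g')" by (cases q)
  have tg: "t \<in> carrier (C2 H I)" "g \<in> carrier (C1 H I)"
    "t' \<in> carrier (C2 H I)" "g' \<in> carrier (C1 H I)" using C_of_Z p q by auto
  obtain f where f: "f \<in> hom (mid (E q)) (mid (E p))"
    "\<And>x. x \<in> carrier (mid (E q)) \<Longrightarrow> f (rbop (E q) x) = rbop (E p) (f x)"
    "\<And>y. y \<in> carrier I \<Longrightarrow> f (incl (E q) y) = incl (E p) y"
    "\<And>x. x \<in> carrier (mid (E q)) \<Longrightarrow> fst (f x) = fst x"
    using assms(3) by (auto simp: ext_equiv_def rb_hom_def)
  define \<theta> where "\<theta> = (\<lambda>h\<in>carrier H. snd (f (h, \<^bold>0)))"
  have fc: "f x \<in> carrier H \<times> carrier I" if "x \<in> carrier H \<times> carrier I" for x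
    using f(1) that by (auto simp: hom_def)
  have f0: "f (h, \<^bold>0) = (h, \<theta> h)" if "h \<in> carrier H" for h
    using f(4)[of "(h, \<^bold>0)"] that by (simp add: \<theta>_def prod_eq_iff)
  have \<theta>: "\<theta> \<in> carrier (C1 H I)"
    using fc f(3)[of "\<^bold>0"] by (force simp: C1_carrier \<theta>_def)
  note [simp] = C1_closed[OF \<theta>] C1_one[OF \<theta>] C1_closed[OF tg(2)] C1_closed[OF tg(4)] C2_closed[OF tg(1)] C2_closed[OF tg(3)]
  have fs: "f (h, y) = (h, \<theta> h \<^bold>+ y)" if "h \<in> carrier H" "y \<in> carrier I" for h y
  proof -
    have "f ((h, \<^bold>0) \<otimes>\<^bsub>mid (E q)\<^esub> (\<one>\<^bsub>H\<^esub>, y)) = (h, \<theta> h) \<otimes>\<^bsub>mid (E p)\<^esub> (\<one>\<^bsub>H\<^esub>, y)"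
      using that hom_mult[OF f(1), of "(h, \<^bold>0)" "(\<one>\<^bsub>H\<^esub>, y)"] f(3)[of y] by (simp add: f0)
    then show ?thesis using that tg by (simp add: C2_one)
  qed
  have "t' (h, k) = t (h, k) \<^bold>+ delta1 H I mu \<theta> (h, k)" if [simp]: "h \<in> carrier H" "k \<in> carrier H" for h k
  proof -
    have "f ((h, \<^bold>0) \<otimes>\<^bsub>mid (E q)\<^esub> (k, \<^bold>0)) = (h, \<theta> h) \<otimes>\<^bsub>mid (E p)\<^esub> (k, \<theta> k)"
      using hom_mult[OF f(1), of "(h, \<^bold>0)" "(k, \<^bold>0)"] by (simp add: f0)
    then show ?thesis
      by (simp add: fs delta1_def I.inv_eq_quot I.quot_simps I.m_ac)
  qed
  moreover have "g' h = g h \<^bold>+ \<^bold>- Phi1 H RH I RI mu \<theta> h" if [simp]: "h \<in> carrier H" for h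
  proof -
    have "f (rbop (E q) (h, \<^bold>0)) = rbop (E p) (h, \<theta> h)"
      using f(2)[of "(h, \<^bold>0)"] by (simp add: f0)
    then show ?thesis
      by (simp add: fs Phi1_def I.inv_eq_quot I.quot_simps I.m_ac)
  qed
  ultimately have "q = p \<otimes>\<^bsub>Z\<^esub> cob \<theta>"
    using tg(3,4) by (auto simp: Z_mult cob_def C1_carrier C2_carrier PiE_iff extensional_def fun_eq_iff)
  with \<theta> show ?thesis by blast
qed

section \<open>Classes of extensions\<close>

abbreviation "K \<equiv> H2 H RH I RI mu"

abbreviation cls :: "('h, 'i, 'f) rb_ext \<Rightarrow> ('h, 'i, 'h \<times> 'i) rb_ext set" where
  "cls \<equiv> ext_class H RH I RI"

sublocale Z: comm_group Z by (rule comm_group_Z)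

sublocale B: normal B Z using subgroup_B by (simp add: Z.normal_iff_subgroup)

lemma cls_E_eq_iff:
  assumes p: "p \<in> carrier Z" and q: "q \<in> carrier Z"
  shows "cls (E q) = cls (E p) \<longleftrightarrow> B #>\<^bsub>Z\<^esub> q = B #>\<^bsub>Z\<^esub> p"
proof -
  have "cls (E q) = cls (E p) \<longleftrightarrow> (\<exists>\<theta>\<in>carrier (C1 H I). q = p \<otimes>\<^bsub>Z\<^esub> cob \<theta>)"
    using ext_class_eq_iff[OF rb_extension_E[OF q] rb_extension_E[OF p]]
      ext_equiv_E_imp_cob[OF p q] ext_equiv_E_shift[OF p] by blast
  also have "\<dots> \<longleftrightarrow> (\<exists>b\<in>B. q = p \<otimes>\<^bsub>Z\<^esub> b)"
    by (simp add: B2_eq)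
  also have "\<dots> \<longleftrightarrow> q \<otimes>\<^bsub>Z\<^esub> inv\<^bsub>Z\<^esub> p \<in> B"
    using p q by (auto simp: Z.m_comm[of p] B.mem_carrier Z.m_assoc intro!: bexI[of _ "q \<otimes>\<^bsub>Z\<^esub> inv\<^bsub>Z\<^esub> p"])
  finally show ?thesis using p q by (simp add: Z.rcos_eq_iff[OF subgroup_B])
qed

lemma comm_group_H2: "comm_group K"
  unfolding H2_def by (rule Z.abelian_FactGroup[OF subgroup_B])

lemma H2_carrier: "carrier K = (\<lambda>q. B #>\<^bsub>Z\<^esub> q) ` carrier Z"
  by (simp add: H2_def carrier_FactGroup)

lemma H2_mult:
  "p \<in> carrier Z \<Longrightarrow> q \<in> carrier Z \<Longrightarrow> (B #>\<^bsub>Z\<^esub> p) \<otimes>\<^bsub>K\<^esub> (B #>\<^bsub>Z\<^esub> q) = B #>\<^bsub>Z\<^esub> (p \<otimes>\<^bsub>Z\<^esub> q)"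
  by (simp add: H2_def B.rcos_sum)

lemma rcos_mult_cong:
  assumes "p \<in> carrier Z" "q \<in> carrier Z" "p' \<in> carrier Z" "q' \<in> carrier Z"
    and "B #>\<^bsub>Z\<^esub> p' = B #>\<^bsub>Z\<^esub> p" "B #>\<^bsub>Z\<^esub> q' = B #>\<^bsub>Z\<^esub> q"
  shows "B #>\<^bsub>Z\<^esub> (p' \<otimes>\<^bsub>Z\<^esub> q') = B #>\<^bsub>Z\<^esub> (p \<otimes>\<^bsub>Z\<^esub> q)"
  using assms H2_mult by metis

text \<open>The content is independence of representatives: only when all admissible choices of
  cocycles give one class does \<open>the_elem\<close> have a meaningful value.\<close>

lemma translate_E:
  assumes p: "p \<in> carrier Z" and q: "q \<in> carrier Z"
  shows "ext_translate H RH I RI mu (cls (E p)) (B #>\<^bsub>Z\<^esub> q) = cls (E (p \<otimes>\<^bsub>Z\<^esub> q))"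
proof -
  have "{cls (E (p' \<otimes>\<^bsub>Z\<^esub> q')) | p' q'. p' \<in> carrier Z \<and> cls (E p') = cls (E p) \<and> q' \<in> B #>\<^bsub>Z\<^esub> q}
      = {cls (E (p \<otimes>\<^bsub>Z\<^esub> q))}"
  proof (intro equalityI subsetI)
    fix c assume "c \<in> {cls (E (p' \<otimes>\<^bsub>Z\<^esub> q')) | p' q'. p' \<in> carrier Z \<and> cls (E p') = cls (E p) \<and> q' \<in> B #>\<^bsub>Z\<^esub> q}"
    then obtain p' q' where c: "c = cls (E (p' \<otimes>\<^bsub>Z\<^esub> q'))" "p' \<in> carrier Z" "cls (E p') = cls (E p)"
      and q': "q' \<in> B #>\<^bsub>Z\<^esub> q" by blast
    have "q' \<in> carrier Z" using B.elemrcos_carrier[OF Z.is_group q q'] .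
    then show "c \<in> {cls (E (p \<otimes>\<^bsub>Z\<^esub> q))}"
      using c q' p q Z.repr_independence[OF q' q subgroup_B]
      by (simp add: cls_E_eq_iff) (metis rcos_mult_cong)
  qed (use p Z.rcos_self[OF q subgroup_B] in blast)
  then show ?thesis by (simp add: ext_translate_def)
qed

text \<open>Transitivity and faithfulness of the translation action in one: the difference of the
  cocycles moves one class to the other, and any class that does so equals this difference modulo
  coboundaries.\<close>

lemma the_translation:
  assumes p: "p \<in> carrier Z" and q: "q \<in> carrier Z"
  shows "(THE k. k \<in> carrier K \<and> cls (E q) = ext_translate H RH I RI mu (cls (E p)) k)
    = B #>\<^bsub>Z\<^esub> (q \<otimes>\<^bsub>Z\<^esub> inv\<^bsub>Z\<^esub> p)"
proof (rule the_equality)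
  have "p \<otimes>\<^bsub>Z\<^esub> (q \<otimes>\<^bsub>Z\<^esub> inv\<^bsub>Z\<^esub> p) = q"
    using p q by (simp add: Z.m_comm[of q] Z.m_assoc[symmetric])
  then show "B #>\<^bsub>Z\<^esub> (q \<otimes>\<^bsub>Z\<^esub> inv\<^bsub>Z\<^esub> p) \<in> carrier K \<and>
      cls (E q) = ext_translate H RH I RI mu (cls (E p)) (B #>\<^bsub>Z\<^esub> (q \<otimes>\<^bsub>Z\<^esub> inv\<^bsub>Z\<^esub> p))"
    using p q by (simp add: H2_carrier translate_E)
next
  fix k assume k: "k \<in> carrier K \<and> cls (E q) = ext_translate H RH I RI mu (cls (E p)) k"
  then obtain r where r: "r \<in> carrier Z" "k = B #>\<^bsub>Z\<^esub> r" by (auto simp: H2_carrier)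
  then have "B #>\<^bsub>Z\<^esub> q = B #>\<^bsub>Z\<^esub> (p \<otimes>\<^bsub>Z\<^esub> r)"
    using k p q by (simp add: translate_E cls_E_eq_iff)
  then have "B #>\<^bsub>Z\<^esub> (q \<otimes>\<^bsub>Z\<^esub> inv\<^bsub>Z\<^esub> p) = B #>\<^bsub>Z\<^esub> (p \<otimes>\<^bsub>Z\<^esub> r \<otimes>\<^bsub>Z\<^esub> inv\<^bsub>Z\<^esub> p)"
    using p q r by (intro rcos_mult_cong) auto
  also have "p \<otimes>\<^bsub>Z\<^esub> r \<otimes>\<^bsub>Z\<^esub> inv\<^bsub>Z\<^esub> p = r"
    using p r by (simp add: Z.m_comm[of p r] Z.m_assoc)
  finally show "k = B #>\<^bsub>Z\<^esub> (q \<otimes>\<^bsub>Z\<^esub> inv\<^bsub>Z\<^esub> p)" by (simp add: r)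
qed

end

section \<open>Groups of automorphisms\<close>

text \<open>Both the Rota-Baxter automorphisms and those normalizing I inherit their group structure
  from the bijections by this criterion.\<close>

lemma subgroup_BijGroup:
  assumes "S \<subseteq> Bij A" "(\<lambda>x\<in>A. x) \<in> S"
    and "\<And>f g. f \<in> S \<Longrightarrow> g \<in> S \<Longrightarrow> compose A f g \<in> S"
    and "\<And>f. f \<in> S \<Longrightarrow> restrict (inv_into A f) A \<in> S"
  shows "subgroup S (BijGroup A)"
proof (rule subgroup.intro)
  show "f \<otimes>\<^bsub>BijGroup A\<^esub> g \<in> S" if "f \<in> S" "g \<in> S" for f g
    using that assms(1,3) by (auto simp: BijGroup_def)
  show "inv\<^bsub>BijGroup A\<^esub> f \<in> S" if "f \<in> S" for f
    using that assms(1,4) by (metis inv_BijGroup subsetD)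
qed (use assms in \<open>auto simp: BijGroup_def\<close>)

lemma rb_auto_iff:
  "f \<in> rb_auto G R \<longleftrightarrow> f \<in> extensional (carrier G) \<and> bij_betw f (carrier G) (carrier G) \<and>
     (\<forall>x\<in>carrier G. \<forall>y\<in>carrier G. f (x \<otimes>\<^bsub>G\<^esub> y) = f x \<otimes>\<^bsub>G\<^esub> f y) \<and>
     (\<forall>x\<in>carrier G. f (R x) = R (f x))"
  by (auto simp: rb_auto_def auto_def Bij_def hom_def dest: bij_betw_imp_funcset)

lemma rb_autoD:
  assumes "f \<in> rb_auto G R"
  shows "f \<in> extensional (carrier G)"
    and "inj_on f (carrier G)"
    and "f ` carrier G = carrier G"
    and "f \<in> hom G G"
    and "x \<in> carrier G \<Longrightarrow> f x \<in> carrier G"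
    and "x \<in> carrier G \<Longrightarrow> y \<in> carrier G \<Longrightarrow> f (x \<otimes>\<^bsub>G\<^esub> y) = f x \<otimes>\<^bsub>G\<^esub> f y"
    and "x \<in> carrier G \<Longrightarrow> f (R x) = R (f x)"
    and "x \<in> carrier G \<Longrightarrow> inv_into (carrier G) f x \<in> carrier G"
    and "x \<in> carrier G \<Longrightarrow> inv_into (carrier G) f (f x) = x"
    and "x \<in> carrier G \<Longrightarrow> f (inv_into (carrier G) f x) = x"
  using assms
  by (auto simp: rb_auto_iff bij_betw_def hom_def inv_into_into f_inv_into_f)

lemma rb_autoI:
  assumes "f \<in> extensional (carrier G)" "inj_on f (carrier G)" "f ` carrier G = carrier G"
    and "\<And>x y. x \<in> carrier G \<Longrightarrow> y \<in> carrier G \<Longrightarrow> f (x \<otimes>\<^bsub>G\<^esub> y) = f x \<otimes>\<^bsub>G\<^esub> f y"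
    and "\<And>x. x \<in> carrier G \<Longrightarrow> f (R x) = R (f x)"
  shows "f \<in> rb_auto G R"
  using assms by (auto simp: rb_auto_iff bij_betw_def)

context rota_baxter_group
begin

lemma id_rb_auto: "(\<lambda>x\<in>carrier G. x) \<in> rb_auto G R"
  by (rule rb_autoI) (auto simp: inj_on_def)

lemma compose_rb_auto:
  assumes "f \<in> rb_auto G R" "g \<in> rb_auto G R"
  shows "compose (carrier G) f g \<in> rb_auto G R"
  using assms
  by (auto simp: rb_auto_iff compose_eq bij_betw_compose bij_betw_apply)

lemma inv_rb_auto:
  assumes f: "f \<in> rb_auto G R"
  shows "restrict (inv_into (carrier G) f) (carrier G) \<in> rb_auto G R"
proof (rule rb_autoI)
  show "inj_on (restrict (inv_into (carrier G) f) (carrier G)) (carrier G)"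
    "restrict (inv_into (carrier G) f) (carrier G) ` carrier G = carrier G"
    using bij_betw_inv_into[of f "carrier G" "carrier G"] f by (auto simp: bij_betw_def rb_auto_iff)
  fix x y assume xy: "x \<in> carrier G" "y \<in> carrier G"
  note inj = inj_onD[OF rb_autoD(2)[OF f]]
  show "restrict (inv_into (carrier G) f) (carrier G) (x \<otimes> y) =
      restrict (inv_into (carrier G) f) (carrier G) x \<otimes> restrict (inv_into (carrier G) f) (carrier G) y"
    by (rule inj) (use xy in \<open>simp_all add: rb_autoD[OF f]\<close>)
  show "restrict (inv_into (carrier G) f) (carrier G) (R x) = R (restrict (inv_into (carrier G) f) (carrier G) x)"
    by (rule inj) (use xy in \<open>simp_all add: rb_autoD[OF f]\<close>)
qed simp

lemma rb_auto_Bij: "rb_auto G R \<subseteq> Bij (carrier G)"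
  by (auto simp: rb_auto_def auto_def)

lemma subgroup_rb_auto: "subgroup (rb_auto G R) (BijGroup (carrier G))"
  by (rule subgroup_BijGroup[OF rb_auto_Bij id_rb_auto compose_rb_auto inv_rb_auto])

lemma rb_AutoGroup_eq: "rb_AutoGroup G R = BijGroup (carrier G)\<lparr>carrier := rb_auto G R\<rparr>"
  by (simp add: rb_AutoGroup_def AutoGroup_def)

lemma group_rb_AutoGroup: "group (rb_AutoGroup G R)"
  unfolding rb_AutoGroup_eq by (rule subgroup.subgroup_is_group[OF subgroup_rb_auto group_BijGroup])

lemma rb_AutoGroup_simps:
  "carrier (rb_AutoGroup G R) = rb_auto G R"
  "\<one>\<^bsub>rb_AutoGroup G R\<^esub> = (\<lambda>x\<in>carrier G. x)"
  "f \<in> rb_auto G R \<Longrightarrow> g \<in> rb_auto G R \<Longrightarrow> f \<otimes>\<^bsub>rb_AutoGroup G R\<^esub> g = compose (carrier G) f g"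
  using rb_auto_Bij by (auto simp: rb_AutoGroup_eq BijGroup_def)

lemma inv_rb_AutoGroup:
  assumes "f \<in> rb_auto G R"
  shows "inv\<^bsub>rb_AutoGroup G R\<^esub> f = restrict (inv_into (carrier G) f) (carrier G)"
  using assms rb_auto_Bij group.m_inv_consistent[OF group_BijGroup subgroup_rb_auto assms]
  by (auto simp: rb_AutoGroup_eq inv_BijGroup)

end

section \<open>Compatible pairs and twisting by them\<close>

context rb_module
begin

abbreviation "C\<mu> \<equiv> C_mu H RH I RI mu"

text \<open>Applying \<psi> to the defining equation removes its inverse and leaves the equivariance
  used in all later calculations.\<close>

lemma C_mu_iff:
  "(\<phi>, \<psi>) \<in> carrier C\<mu> \<longleftrightarrow> \<phi> \<in> rb_auto H RH \<and> \<psi> \<in> rb_auto I RI \<and>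
     (\<forall>h\<in>carrier H. \<forall>y\<in>carrier I. \<psi> (mu h y) = mu (\<phi> h) (\<psi> y))"
proof -
  have "mu h y = inv_into (carrier I) \<psi> (mu (\<phi> h) (\<psi> y)) \<longleftrightarrow> \<psi> (mu h y) = mu (\<phi> h) (\<psi> y)"
    if "\<phi> \<in> rb_auto H RH" "\<psi> \<in> rb_auto I RI" "h \<in> carrier H" "y \<in> carrier I" for h y
    using that rb_autoD(9,10)[OF that(2)] by (metis mu_closed rb_autoD(5))
  then show ?thesis by (auto simp: C_mu_def)
qed

lemma C_mu_mult:
  assumes "(\<phi>, \<psi>) \<in> carrier C\<mu>" "(\<phi>', \<psi>') \<in> carrier C\<mu>"
  shows "(\<phi>, \<psi>) \<otimes>\<^bsub>C\<mu>\<^esub> (\<phi>', \<psi>') = (compose (carrier H) \<phi> \<phi>', compose (carrier I) \<psi> \<psi>')"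
  using assms by (simp add: C_mu_iff) (simp add: C_mu_def H.rb_AutoGroup_simps I.rb_AutoGroup_simps)

lemma C_mu_one: "\<one>\<^bsub>C\<mu>\<^esub> = ((\<lambda>h\<in>carrier H. h), (\<lambda>y\<in>carrier I. y))"
  by (simp add: C_mu_def H.rb_AutoGroup_simps I.rb_AutoGroup_simps)

lemma group_C_mu: "group C\<mu>"
proof -
  let ?P = "rb_AutoGroup H RH \<times>\<times> rb_AutoGroup I RI"
  have P: "group ?P"
    by (rule DirProd_group[OF H.group_rb_AutoGroup I.group_rb_AutoGroup])
  have "subgroup (carrier C\<mu>) ?P"
  proof (rule subgroup.intro)
    show "carrier C\<mu> \<subseteq> carrier ?P"
      by (auto simp: C_mu_iff H.rb_AutoGroup_simps I.rb_AutoGroup_simps)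
    show "\<one>\<^bsub>?P\<^esub> \<in> carrier C\<mu>"
      by (simp add: C_mu_iff H.rb_AutoGroup_simps I.rb_AutoGroup_simps H.id_rb_auto I.id_rb_auto)
    show "x \<otimes>\<^bsub>?P\<^esub> y \<in> carrier C\<mu>" if "x \<in> carrier C\<mu>" "y \<in> carrier C\<mu>" for x y
      using that by (cases x; cases y) (auto simp: C_mu_iff H.rb_AutoGroup_simps I.rb_AutoGroup_simps
          H.compose_rb_auto I.compose_rb_auto compose_eq rb_autoD)
    show "inv\<^bsub>?P\<^esub> x \<in> carrier C\<mu>" if "x \<in> carrier C\<mu>" for x
    proof -
      obtain \<phi> \<psi> where x: "x = (\<phi>, \<psi>)" by (cases x)
      have c: "\<phi> \<in> rb_auto H RH" "\<psi> \<in> rb_auto I RI"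
        "\<And>h y. h \<in> carrier H \<Longrightarrow> y \<in> carrier I \<Longrightarrow> \<psi> (mu h y) = mu (\<phi> h) (\<psi> y)"
        using that by (auto simp: x C_mu_iff)
      have "inv_into (carrier I) \<psi> (mu h y) =
          mu (inv_into (carrier H) \<phi> h) (inv_into (carrier I) \<psi> y)"
        if "h \<in> carrier H" "y \<in> carrier I" for h y
        by (rule inj_onD[OF rb_autoD(2)[OF c(2)]])
          (use that c(3) in \<open>simp_all add: rb_autoD[OF c(1)] rb_autoD[OF c(2)]\<close>)
      then show ?thesis
        using c by (simp add: x inv_DirProd[OF H.group_rb_AutoGroup I.group_rb_AutoGroup]
            H.rb_AutoGroup_simps I.rb_AutoGroup_simps H.inv_rb_AutoGroup I.inv_rb_AutoGroup
            C_mu_iff H.inv_rb_auto I.inv_rb_auto rb_autoD)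
    qed
  qed
  then have "group (?P\<lparr>carrier := carrier C\<mu>\<rparr>)"
    by (rule subgroup.subgroup_is_group[OF _ P])
  then show ?thesis by (simp add: C_mu_def)
qed

lemma rb_extension_twist:
  assumes X: "rb_extension H RH I RI X" and c: "(\<phi>, \<psi>) \<in> carrier C\<mu>"
  shows "rb_extension H RH I RI (ext_twist H X (\<phi>, \<psi>))"
proof -
  note X' = rb_extensionD[OF X]
  have c1: "\<phi> \<in> rb_auto H RH" and c2: "\<psi> \<in> rb_auto I RI" using c by (auto simp: C_mu_iff)
  note \<phi> = rb_autoD[OF c1] and \<psi> = rb_autoD[OF c2]
  have inv: "restrict (inv_into (carrier H) \<phi>) (carrier H) \<in> rb_auto H RH"
    by (rule H.inv_rb_auto[OF c1])
  have inv_mult: "inv_into (carrier H) \<phi> (x \<cdot> y) = inv_into (carrier H) \<phi> x \<cdot> inv_into (carrier H) \<phi> y"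
    if "x \<in> carrier H" "y \<in> carrier H" for x y
    using rb_autoD(6)[OF inv that] that by simp
  have inv_RH: "inv_into (carrier H) \<phi> (RH x) = RH (inv_into (carrier H) \<phi> x)"
    if "x \<in> carrier H" for x
    using rb_autoD(7)[OF inv that] that by simp
  interpret \<phi>: group_hom H H \<phi> using \<phi>(4) by unfold_locales
  have inv_one: "inv_into (carrier H) \<phi> x = \<one>\<^bsub>H\<^esub> \<longleftrightarrow> x = \<one>\<^bsub>H\<^esub>" if "x \<in> carrier H" for x
    using \<phi>(9)[of "\<one>\<^bsub>H\<^esub>"] \<phi>(10)[OF that] \<phi>.hom_one by auto
  have "(incl X \<circ> \<psi>) ` carrier I = incl X ` carrier I"
    by (simp only: image_comp[symmetric] \<psi>(3))
  moreover have "(inv_into (carrier H) \<phi> \<circ> proj X) ` carrier (mid X) = carrier H"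
    using rb_autoD(3)[OF inv] by (simp only: image_comp[symmetric] X'(14)) simp
  moreover have "inj_on (incl X \<circ> \<psi>) (carrier I)"
    using X'(12) \<psi>(2,3) by (simp add: comp_inj_on)
  moreover have "kernel (mid X) H (inv_into (carrier H) \<phi> \<circ> proj X) = kernel (mid X) H (proj X)"
    by (auto simp: kernel_def inv_one X'(8))
  moreover have "incl X \<circ> \<psi> \<in> rb_hom I RI (mid X) (rbop X)"
    using X'(5) by (auto simp: rb_hom_def hom_def \<psi>(5-7) X'(7,10))
  moreover have "inv_into (carrier H) \<phi> \<circ> proj X \<in> rb_hom (mid X) (rbop X) H RH"
    using X'(6) by (auto simp: rb_hom_def hom_def \<phi>(8) X'(8,11) inv_mult inv_RH)
  ultimately show ?thesis
    by (simp add: rb_extension_def ext_twist_def X'(4,13)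
        H.rota_baxter_group_axioms I.rota_baxter_group_axioms)
qed

text \<open>The same isomorphism serves, since twisting only composes inclusion and projection with
  maps that do not depend on the extension.\<close>

lemma ext_equiv_twist:
  assumes "ext_equiv I X Y" "c \<in> carrier C\<mu>"
  shows "ext_equiv I (ext_twist H X c) (ext_twist H Y c)"
proof -
  obtain \<phi> \<psi> where [simp]: "c = (\<phi>, \<psi>)" by (cases c)
  obtain f where "f \<in> iso (mid X) (mid Y) \<inter> rb_hom (mid X) (rbop X) (mid Y) (rbop Y)"
    "\<And>y. y \<in> carrier I \<Longrightarrow> f (incl X y) = incl Y y"
    "\<And>x. x \<in> carrier (mid X) \<Longrightarrow> proj Y (f x) = proj X x"
    using assms(1) by (auto simp: ext_equiv_def)
  then show ?thesis
    using assms(2) unfolding ext_equiv_def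
    by (intro bexI[of _ f]) (auto simp: ext_twist_def C_mu_iff rb_autoD)
qed

lemma cocycle_twist_in_Z:
  assumes p: "p \<in> carrier Z" and c: "c \<in> carrier C\<mu>"
  shows "cocycle_twist H I c p \<in> carrier Z"
    and "ext_equiv I (E (cocycle_twist H I c p)) (ext_twist H (E p) c)"
proof -
  obtain \<phi> \<psi> where c_eq [simp]: "c = (\<phi>, \<psi>)" by (cases c)
  have c1: "\<phi> \<in> rb_auto H RH" and c2: "\<psi> \<in> rb_auto I RI"
    and mu: "\<And>h y. h \<in> carrier H \<Longrightarrow> y \<in> carrier I \<Longrightarrow> mu (\<phi> h) (\<psi> y) = \<psi> (mu h y)"
    using c by (auto simp: C_mu_iff)
  note \<phi> = rb_autoD[OF c1] and \<psi> = rb_autoD[OF c2]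
  interpret \<phi>: group_hom H H \<phi> using \<phi>(4) by unfold_locales
  interpret \<psi>: group_hom I I \<psi> using \<psi>(4) by unfold_locales
  obtain t g where p_eq [simp]: "p = (t, g)" by (cases p)
  have tg: "t \<in> carrier (C2 H I)" "g \<in> carrier (C1 H I)" using C_of_Z p by auto
  note [simp] = C1_closed[OF tg(2)] C1_one[OF tg(2)] C2_closed[OF tg(1)] C2_one[OF tg(1)]
  define t' where "t' = restrict (\<lambda>(h1, h2). inv_into (carrier I) \<psi> (t (\<phi> h1, \<phi> h2))) (carrier H \<times> carrier H)"
  define g' where "g' = (\<lambda>h\<in>carrier H. inv_into (carrier I) \<psi> (g (\<phi> h)))"
  have twist: "cocycle_twist H I c p = (t', g')"
    by (simp add: cocycle_twist_def t'_def g'_def)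
  have inv_zero: "inv_into (carrier I) \<psi> \<^bold>0 = \<^bold>0"
    using \<psi>(9)[of "\<^bold>0"] \<psi>.hom_one by simp
  have C': "t' \<in> carrier (C2 H I)" "g' \<in> carrier (C1 H I)"
    by (auto simp: C2_carrier C1_carrier t'_def g'_def \<phi>(5) \<psi>(8) inv_zero)
  have t'g' [simp]: "\<psi> (t' (h, k)) = t (\<phi> h, \<phi> k)" "\<psi> (g' h) = g (\<phi> h)"
    if "h \<in> carrier H" "k \<in> carrier H" for h k
    using that by (simp_all add: t'_def g'_def \<phi>(5) \<psi>(10))
  note [simp] = C1_closed[OF C'(2)] C2_closed[OF C'(1)]
  \<comment> \<open>The map runs from the twisted structure to the one of \<open>p\<close>. It
    induces \<psi> on I and \<phi> on H, and these are what \<open>ext_twist\<close> absorbs into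
    inclusion and projection; hence it is an equivalence with the twisted extension.\<close>
  define f where "f = (\<lambda>(h, y). (\<phi> h, \<psi> y))"
  have bij: "bij_betw f (carrier H \<times> carrier I) (carrier H \<times> carrier I)"
    by (rule bij_betw_byWitness[where f' = "\<lambda>(h, y). (inv_into (carrier H) \<phi> h, inv_into (carrier I) \<psi> y)"])
      (auto simp: f_def \<phi>(5,8-10) \<psi>(5,8-10))
  have f_mult: "f (x \<otimes>\<^bsub>mid (E (t', g'))\<^esub> y) = f x \<otimes>\<^bsub>mid (E (t, g))\<^esub> f y"
    if "x \<in> carrier H \<times> carrier I" "y \<in> carrier H \<times> carrier I" for x y
    using that by (auto simp: f_def mu)
  have f_rbop: "f (rbop (E (t', g')) x) = rbop (E (t, g)) (f x)" if "x \<in> carrier H \<times> carrier I" for x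
    using that by (auto simp: f_def \<psi>(7) mu simp flip: \<phi>(7))
  have rb: "rota_baxter_group (mid (E (t, g))) (rbop (E (t, g)))"
    using Z2_iff[OF tg] p by simp
  have Z': "(t', g') \<in> carrier Z"
    by (rule pullback_in_Z2[OF C' rb, of f])
      (use bij bij_betw_imp_funcset[OF bij] f_mult f_rbop in \<open>auto simp: bij_betw_def simp del: E_simps(2,4)\<close>)
  then show "cocycle_twist H I c p \<in> carrier Z" by (simp only: twist)
  have "f \<in> hom (mid (E (t', g'))) (mid (E (t, g)))"
    using f_mult bij_betw_imp_funcset[OF bij] by (auto simp: hom_def simp del: E_simps(2))
  then show "ext_equiv I (E (cocycle_twist H I c p)) (ext_twist H (E p) c)"
    unfolding ext_equiv_def twist
    using bij f_rbop by (intro bexI[of _ f])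
      (auto simp: iso_def rb_hom_def ext_twist_def f_def \<phi>(9) simp del: E_simps(2,4))
qed

lemma cocycle_twist_mult:
  assumes "p \<in> carrier Z" "q \<in> carrier Z" "c \<in> carrier C\<mu>"
  shows "cocycle_twist H I c (p \<otimes>\<^bsub>Z\<^esub> q) = cocycle_twist H I c p \<otimes>\<^bsub>Z\<^esub> cocycle_twist H I c q"
proof -
  obtain \<phi> \<psi> where c_eq [simp]: "c = (\<phi>, \<psi>)" by (cases c)
  have c1: "\<phi> \<in> rb_auto H RH" and c2: "\<psi> \<in> rb_auto I RI"
    using assms(3) by (auto simp: C_mu_iff)
  have "inv_into (carrier I) \<psi> (x \<^bold>+ y) = inv_into (carrier I) \<psi> x \<^bold>+ inv_into (carrier I) \<psi> y"
    if "x \<in> carrier I" "y \<in> carrier I" for x y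
    using rb_autoD(6)[OF I.inv_rb_auto[OF c2] that] that by simp
  then show ?thesis
    using assms(1,2) by (cases p; cases q) (auto dest!: C_of_Z intro!: restrict_ext
        simp: cocycle_twist_def Z_mult C_simps rb_autoD[OF c1])
qed

text \<open>Twisting commutes with \<open>cob\<close>: the twist of \<open>cob \<theta>\<close> is
  \<open>cob\<close> of the twisted cochain \<theta>', by the equivariance of \<open>mu\<close> and
  because \<phi> and \<psi> commute with the operators.\<close>

lemma cocycle_twist_B:
  assumes "b \<in> B" and c: "c \<in> carrier C\<mu>"
  shows "cocycle_twist H I c b \<in> B"
proof -
  obtain \<phi> \<psi> where c_eq [simp]: "c = (\<phi>, \<psi>)" by (cases c)
  obtain \<theta> where b: "b = cob \<theta>" and \<theta>: "\<theta> \<in> carrier (C1 H I)"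
    using assms(1) by (auto simp: B2_eq)
  have c1: "\<phi> \<in> rb_auto H RH" and c2: "\<psi> \<in> rb_auto I RI"
    and mu: "\<And>h y. h \<in> carrier H \<Longrightarrow> y \<in> carrier I \<Longrightarrow> mu (\<phi> h) (\<psi> y) = \<psi> (mu h y)"
    using c by (auto simp: C_mu_iff)
  note \<phi> = rb_autoD[OF c1] and \<psi> = rb_autoD[OF c2]
  interpret \<phi>: group_hom H H \<phi> using \<phi>(4) by unfold_locales
  interpret \<psi>: group_hom I I \<psi> using \<psi>(4) by unfold_locales
  define \<theta>' where "\<theta>' = (\<lambda>h\<in>carrier H. inv_into (carrier I) \<psi> (\<theta> (\<phi> h)))"
  have inv_zero: "inv_into (carrier I) \<psi> \<^bold>0 = \<^bold>0"
    using \<psi>(9)[of "\<^bold>0"] \<psi>.hom_one by simp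
  have \<theta>': "\<theta>' \<in> carrier (C1 H I)"
    unfolding C1_carrier \<theta>'_def using \<theta> by (auto simp: \<psi>(8) C_simps \<phi>(5) inv_zero)
  have t: "\<theta> (\<phi> h) = \<psi> (\<theta>' h)" if "h \<in> carrier H" for h
    using that \<theta> by (simp add: \<theta>'_def \<psi>(10) C_simps)
  note [simp] = C1_closed[OF \<theta>']
  have "delta1 H I mu \<theta> (\<phi> h, \<phi> k) = \<psi> (delta1 H I mu \<theta>' (h, k))"
    if "h \<in> carrier H" "k \<in> carrier H" for h k
    using that by (simp add: delta1_def t mu flip: \<phi>.hom_mult)
  moreover have "\<^bold>- Phi1 H RH I RI mu \<theta> (\<phi> h) = \<psi> (\<^bold>- Phi1 H RH I RI mu \<theta>' h)"
    if "h \<in> carrier H" for h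
    using that by (simp add: Phi1_def t mu flip: \<phi>(7) \<psi>(7))
  ultimately have "cocycle_twist H I c b = (restrict (delta1 H I mu \<theta>') (carrier H \<times> carrier H),
      restrict (\<lambda>h. \<^bold>- Phi1 H RH I RI mu \<theta>' h) (carrier H))"
    using C2_closed[OF cob_C(1)[OF \<theta>']] C1_closed[OF cob_C(2)[OF \<theta>']]
    by (auto simp: b cocycle_twist_def cob_def \<psi>(9) \<phi>(5) intro!: restrict_ext)
  also have "\<dots> = cob \<theta>'"
    by (simp add: cob_def delta1_def)
  finally have "cocycle_twist H I c b = cob \<theta>'" .
  then show ?thesis using \<theta>' by (simp add: B2_eq)
qed

end

section \<open>Extensions with a section\<close>

text \<open>The theorem assumes membership of the class in \<open>Ext_mu\<close> in place of
  \<open>act\<close>; \<open>has_action_if_in_Ext_mu\<close> passes from one to the other.\<close>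

locale rb_section = rb_module H RH I RI mu
  for H :: "'h monoid" and RH and I :: "'i monoid" and RI mu +
  fixes X :: "('h, 'i, 'e) rb_ext" and s :: "'h \<Rightarrow> 'e"
  assumes ext: "rb_extension H RH I RI X"
    and act: "has_action H I X mu"
    and sec: "st_section H X s"
begin

sublocale G: rota_baxter_group "mid X" "rbop X"
  by (rule rb_extensionD(4)[OF ext])

abbreviation mulE (infixl "\<star>" 70) where "x \<star> y \<equiv> x \<otimes>\<^bsub>mid X\<^esub> y"

lemmas extD = rb_extensionD(7-14)[OF ext]

sublocale incl: group_hom I "mid X" "incl X"
  by unfold_locales (rule rb_extensionD(5)[OF ext])

sublocale proj: group_hom "mid X" H "proj X"
  by unfold_locales (rule rb_extensionD(6)[OF ext])

lemma s_closed [simp]: "h \<in> carrier H \<Longrightarrow> s h \<in> carrier (mid X)"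
  and proj_s [simp]: "h \<in> carrier H \<Longrightarrow> proj X (s h) = h"
  and s_one [simp]: "s \<one>\<^bsub>H\<^esub> = \<one>\<^bsub>mid X\<^esub>"
  using sec by (auto simp: st_section_def)

lemma incl_inject [simp]: "y \<in> carrier I \<Longrightarrow> z \<in> carrier I \<Longrightarrow> incl X y = incl X z \<longleftrightarrow> y = z"
  using extD(6) by (auto dest: inj_onD)

lemma incl_image_iff: "x \<in> incl X ` carrier I \<longleftrightarrow> x \<in> carrier (mid X) \<and> proj X x = \<one>\<^bsub>H\<^esub>"
  unfolding extD(7) by (simp add: kernel_def)

lemma proj_incl [simp]: "y \<in> carrier I \<Longrightarrow> proj X (incl X y) = \<one>\<^bsub>H\<^esub>"
  using incl_image_iff[of "incl X y"] by auto

lemma fibre: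
  assumes "x \<in> carrier (mid X)" "x' \<in> carrier (mid X)" "proj X x = proj X x'"
  obtains y where "y \<in> carrier I" "x = x' \<star> incl X y"
proof -
  have "inv\<^bsub>mid X\<^esub> x' \<star> x \<in> incl X ` carrier I"
    using assms by (simp add: incl_image_iff)
  then obtain y where y: "y \<in> carrier I" "inv\<^bsub>mid X\<^esub> x' \<star> x = incl X y" by auto
  have "x = x' \<star> incl X y"
    using assms y by (simp add: G.inv_solve_left' flip: y(2) G.m_assoc)
  with y show ?thesis using that by blast
qed

text \<open>\<open>has_action\<close> speaks of section values only. A general x differs from the
  section value over the same point by an element of I, which commutes with I and so does not affect
  the conjugation.\<close>

lemma conj_incl:
  assumes x: "x \<in> carrier (mid X)" and y: "y \<in> carrier I"
  shows "x \<star> incl X (mu (proj X x) y) = incl X y \<star> x"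
proof -
  let ?h = "proj X x"
  obtain z where z: "z \<in> carrier I" "x = s ?h \<star> incl X z"
    using fibre[of x "s ?h"] x by auto
  have "incl X (mu ?h y) = inv\<^bsub>mid X\<^esub> (s ?h) \<star> incl X y \<star> s ?h"
    using act sec x y by (simp add: has_action_def)
  then have *: "s ?h \<star> incl X (mu ?h y) = incl X y \<star> s ?h"
    using x y by (subst (asm) G.eq_conj_iff) auto
  have "s ?h \<star> incl X z \<star> incl X (mu ?h y) = s ?h \<star> incl X (z \<^bold>+ mu ?h y)"
    using x y z(1) by (simp add: G.m_assoc)
  also have "\<dots> = s ?h \<star> incl X (mu ?h y) \<star> incl X z"
    using x y z(1) by (simp add: G.m_assoc I.m_comm[of z])
  also have "\<dots> = incl X y \<star> (s ?h \<star> incl X z)"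
    using x y z(1) by (simp add: * G.m_assoc)
  finally show ?thesis by (simp flip: z(2))
qed

lemma cocycle_exists:
  obtains p where "p \<in> carrier Z" "ext_equiv I (E p) X"
proof -
  define t where "t = restrict (\<lambda>(h, k). inv_into (carrier I) (incl X)
    (inv\<^bsub>mid X\<^esub> (s (h \<cdot> k)) \<star> (s h \<star> s k))) (carrier H \<times> carrier H)"
  \<comment> \<open>The order of the factors gives \<open>rbop X (s h)\<close> the correction
    \<open>inv (g h)\<close> relative to \<open>s (RH h)\<close>, the sign used in
    \<open>ext_of_cocycle\<close>.\<close>
  define g where "g = (\<lambda>h\<in>carrier H. inv_into (carrier I) (incl X)
    (inv\<^bsub>mid X\<^esub> (rbop X (s h)) \<star> s (RH h)))"
  have inv_incl: "inv_into (carrier I) (incl X) x \<in> carrier I"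
    "incl X (inv_into (carrier I) (incl X) x) = x"
    if "x \<in> carrier (mid X)" "proj X x = \<one>\<^bsub>H\<^esub>" for x
    using that incl_image_iff[of x] by (auto intro: inv_into_into f_inv_into_f)
  have inv_incl_one: "inv_into (carrier I) (incl X) \<one>\<^bsub>mid X\<^esub> = \<^bold>0"
    by (metis I.one_closed extD(6) incl.hom_one inv_into_f_f)
  have t: "t (h, k) \<in> carrier I" "s (h \<cdot> k) \<star> incl X (t (h, k)) = s h \<star> s k"
    if "h \<in> carrier H" "k \<in> carrier H" for h k
  proof -
    let ?w = "inv\<^bsub>mid X\<^esub> (s (h \<cdot> k)) \<star> (s h \<star> s k)"
    have w: "?w \<in> carrier (mid X)" "proj X ?w = \<one>\<^bsub>H\<^esub>"
      using that by simp_all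
    have "s (h \<cdot> k) \<star> ?w = s h \<star> s k"
      using that by (simp flip: G.m_assoc)
    then show "t (h, k) \<in> carrier I" "s (h \<cdot> k) \<star> incl X (t (h, k)) = s h \<star> s k"
      using that inv_incl[OF w] by (simp_all add: t_def)
  qed
  have g: "g h \<in> carrier I" "rbop X (s h) \<star> incl X (g h) = s (RH h)"
    if "h \<in> carrier H" for h
  proof -
    let ?w = "inv\<^bsub>mid X\<^esub> (rbop X (s h)) \<star> s (RH h)"
    have w: "?w \<in> carrier (mid X)" "proj X ?w = \<one>\<^bsub>H\<^esub>"
      using that by (simp_all add: extD(5))
    have "rbop X (s h) \<star> ?w = s (RH h)"
      using that by (simp flip: G.m_assoc)
    then show "g h \<in> carrier I" "rbop X (s h) \<star> incl X (g h) = s (RH h)"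
      using that inv_incl[OF w] by (simp_all add: g_def)
  qed
  have R_s: "rbop X (s h) = s (RH h) \<star> incl X (\<^bold>- g h)" if "h \<in> carrier H" for h
    using that g(1) by (simp add: G.m_assoc flip: g(2))
  have RX_one: "rbop X \<one>\<^bsub>mid X\<^esub> = \<one>\<^bsub>mid X\<^esub>"
    using extD(4)[of "\<^bold>0"] by simp
  have C: "t \<in> carrier (C2 H I)" "g \<in> carrier (C1 H I)"
  proof -
    have "t \<in> extensional (carrier H \<times> carrier H)" "g \<in> extensional (carrier H)"
      by (simp_all add: t_def g_def)
    moreover have "t (h, \<one>\<^bsub>H\<^esub>) = \<^bold>0" "t (\<one>\<^bsub>H\<^esub>, h) = \<^bold>0" if "h \<in> carrier H" for h
      using that by (simp_all add: t_def inv_incl_one)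
    moreover have "g \<one>\<^bsub>H\<^esub> = \<^bold>0"
      by (simp add: g_def inv_incl_one RX_one)
    ultimately show "t \<in> carrier (C2 H I)" "g \<in> carrier (C1 H I)"
      using t(1) g(1) by (auto simp: C2_carrier C1_carrier PiE_def)
  qed
  define e where "e = (\<lambda>(h, y). s h \<star> incl X y)"
  have e_mult: "e (x \<otimes>\<^bsub>mid (E (t, g))\<^esub> y) = e x \<star> e y"
    if xy: "x \<in> carrier H \<times> carrier I" "y \<in> carrier H \<times> carrier I" for x y
  proof -
    obtain h y1 k y2 where [simp]: "x = (h, y1)" "y = (k, y2)" and
      [simp]: "h \<in> carrier H" "k \<in> carrier H" "y1 \<in> carrier I" "y2 \<in> carrier I"
      using xy by auto
    note [simp] = t(1)
    have "e (x \<otimes>\<^bsub>mid (E (t, g))\<^esub> y) = s (h \<cdot> k) \<star> incl X (t (h, k) \<^bold>+ (mu k y1 \<^bold>+ y2))"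
      by (simp add: e_def I.m_ac)
    also have "\<dots> = s h \<star> (s k \<star> incl X (mu k y1)) \<star> incl X y2"
      by (simp add: G.m_assoc[symmetric] t(2))
    also have "\<dots> = e x \<star> e y"
      using conj_incl[of "s k" y1] by (simp add: e_def G.m_assoc)
    finally show ?thesis .
  qed
  have e_rbop: "e (rbop (E (t, g)) x) = rbop X (e x)" if x: "x \<in> carrier H \<times> carrier I" for x
  proof -
    obtain h y where [simp]: "x = (h, y)" "h \<in> carrier H" "y \<in> carrier I" using x by auto
    note [simp] = g(1)
    let ?r = "rbop X (s h)" and ?z = "incl X (mu (RH h) y)"
    have "?r \<star> ?z = incl X y \<star> ?r"
      using conj_incl[of ?r y] by (simp add: extD(5))
    then have "s h \<star> ?r \<star> ?z \<star> inv\<^bsub>mid X\<^esub> ?r = s h \<star> incl X y"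
      by (simp add: G.m_assoc)
    \<comment> \<open>Conjugation by \<open>?r\<close> turns \<open>?z\<close> back into the image
      of \<open>y\<close>. The Rota-Baxter identity at \<open>s h\<close> and \<open>?z\<close> thus
      computes the operator on \<open>e x\<close> as a product of known values.\<close>
    then have "rbop X (e x) = ?r \<star> rbop X ?z"
      using G.rota_baxter[of "s h" ?z] by (simp add: e_def)
    also have "\<dots> = s (RH h) \<star> incl X (\<^bold>- g h \<^bold>+ RI (mu (RH h) y))"
      by (simp add: extD(4)[symmetric] R_s G.m_assoc)
    finally show ?thesis by (simp add: e_def)
  qed
  have e_inj: "inj_on e (carrier H \<times> carrier I)"
  proof (rule inj_onI; clarify)
    fix h y k z
    assume hk: "h \<in> carrier H" "k \<in> carrier H" "y \<in> carrier I" "z \<in> carrier I" "e (h, y) = e (k, z)"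
    then have "proj X (e (h, y)) = proj X (e (k, z))" by simp
    then have "h = k" using hk by (simp add: e_def)
    then show "h = k \<and> y = z" using hk by (simp add: e_def)
  qed
  have e_im: "e ` (carrier H \<times> carrier I) = carrier (mid X)"
  proof (intro equalityI subsetI)
    fix x assume x: "x \<in> carrier (mid X)"
    obtain y where "y \<in> carrier I" "x = s (proj X x) \<star> incl X y"
      using fibre[of x "s (proj X x)"] x by auto
    then show "x \<in> e ` (carrier H \<times> carrier I)"
      using x by (intro image_eqI[of _ _ "(proj X x, y)"]) (auto simp: e_def)
  qed (auto simp: e_def)
  \<comment> \<open>Both cocycle conditions come from the axioms of the middle group by way of
    \<open>e\<close>.\<close>
  have "(t, g) \<in> carrier Z"
    by (rule pullback_in_Z2[OF C G.rota_baxter_group_axioms e_inj _ e_mult e_rbop])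
      (use e_im in auto)
  moreover have "e \<in> hom (mid (E (t, g))) (mid X)"
    using e_mult e_im by (auto simp: hom_def simp del: E_simps(2))
  then have "ext_equiv I (E (t, g)) X"
    unfolding ext_equiv_def using e_inj e_im e_rbop
    by (intro bexI[of _ e]) (auto simp: iso_def bij_betw_def rb_hom_def e_def simp del: E_simps(2,4))
  ultimately show ?thesis using that by blast
qed

section \<open>The derivation\<close>

abbreviation "\<omega> \<equiv> omega H RH I RI mu X"

lemma omega_eq:
  assumes p: "p \<in> carrier Z" "ext_equiv I (E p) X" and c: "c \<in> carrier C\<mu>"
  shows "\<omega> c = B #>\<^bsub>Z\<^esub> (cocycle_twist H I c p \<otimes>\<^bsub>Z\<^esub> inv\<^bsub>Z\<^esub> p)"
    and "cls (ext_twist H X c) = cls (E (cocycle_twist H I c p))"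
    and "cls X = cls (E p)"
proof -
  note q = cocycle_twist_in_Z[OF p(1) c]
  show X: "cls X = cls (E p)"
    using ext_class_cong[OF rb_extension_E[OF p(1)] ext p(2)] by simp
  have tw: "rb_extension H RH I RI (ext_twist H X c)"
    using rb_extension_twist[OF ext] c by (cases c) auto
  have "ext_equiv I (E (cocycle_twist H I c p)) (ext_twist H X c)"
    using ext_equiv_trans[OF q(2) ext_equiv_twist[OF p(2) c]] .
  then show *: "cls (ext_twist H X c) = cls (E (cocycle_twist H I c p))"
    using ext_class_cong[OF rb_extension_E[OF q(1)] tw] by simp
  show "\<omega> c = B #>\<^bsub>Z\<^esub> (cocycle_twist H I c p \<otimes>\<^bsub>Z\<^esub> inv\<^bsub>Z\<^esub> p)"
    using the_translation[OF p(1) q(1)] by (simp add: omega_def X *)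
qed

lemma omega_closed: "c \<in> carrier C\<mu> \<Longrightarrow> \<omega> c \<in> carrier K"
  using cocycle_exists omega_eq(1) cocycle_twist_in_Z(1) by (metis H2_carrier Z.inv_closed Z.m_closed image_eqI)

lemma omega_eq_one_iff:
  assumes c: "c \<in> carrier C\<mu>"
  shows "\<omega> c = \<one>\<^bsub>K\<^esub> \<longleftrightarrow> cls (ext_twist H X c) = cls X"
proof -
  obtain p where p: "p \<in> carrier Z" "ext_equiv I (E p) X" by (rule cocycle_exists)
  let ?q = "cocycle_twist H I c p"
  have q: "?q \<in> carrier Z" by (rule cocycle_twist_in_Z(1)[OF p(1) c])
  have r: "?q \<otimes>\<^bsub>Z\<^esub> inv\<^bsub>Z\<^esub> p \<in> carrier Z" using p q by simp
  have "\<omega> c = \<one>\<^bsub>K\<^esub> \<longleftrightarrow> B #>\<^bsub>Z\<^esub> (?q \<otimes>\<^bsub>Z\<^esub> inv\<^bsub>Z\<^esub> p) = B"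
    by (simp add: omega_eq(1)[OF p c] H2_def)
  also have "\<dots> \<longleftrightarrow> ?q \<otimes>\<^bsub>Z\<^esub> inv\<^bsub>Z\<^esub> p \<in> B"
    using Z.coset_join1[OF _ r subgroup_B] Z.coset_join2[OF r subgroup_B] by blast
  also have "\<dots> \<longleftrightarrow> B #>\<^bsub>Z\<^esub> ?q = B #>\<^bsub>Z\<^esub> p"
    using p q by (simp add: Z.rcos_eq_iff[OF subgroup_B])
  finally show ?thesis
    using cls_E_eq_iff[OF p(1) q] by (simp add: omega_eq(2,3)[OF p c])
qed

end

section \<open>The right action of compatible pairs on cohomology\<close>

context rb_module
begin

text \<open>Twisting is additive and preserves coboundaries, so all members of a coset have twists
  in one coset; this makes the set under \<open>the_elem\<close> a singleton.\<close>

lemma H2_act_coset: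
  assumes q: "q \<in> carrier Z" and c: "c \<in> carrier C\<mu>"
  shows "H2_act H RH I RI mu (B #>\<^bsub>Z\<^esub> q) c = B #>\<^bsub>Z\<^esub> cocycle_twist H I c q"
proof -
  have "B #>\<^bsub>Z\<^esub> cocycle_twist H I c q' = B #>\<^bsub>Z\<^esub> cocycle_twist H I c q" if "q' \<in> B #>\<^bsub>Z\<^esub> q" for q'
  proof -
    obtain b where b: "b \<in> B" "q' = b \<otimes>\<^bsub>Z\<^esub> q"
      using \<open>q' \<in> B #>\<^bsub>Z\<^esub> q\<close> by (auto simp: r_coset_def)
    have "cocycle_twist H I c q' = cocycle_twist H I c b \<otimes>\<^bsub>Z\<^esub> cocycle_twist H I c q"
      using b q c by (simp add: cocycle_twist_mult B.mem_carrier)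
    moreover have "cocycle_twist H I c q \<in> carrier Z" "cocycle_twist H I c b \<in> B"
      using cocycle_twist_in_Z(1) cocycle_twist_B b q c by blast+
    ultimately show ?thesis
      by (simp add: Z.rcos_eq_iff[OF subgroup_B] B.mem_carrier Z.m_assoc)
  qed
  moreover have "q \<in> B #>\<^bsub>Z\<^esub> q" by (rule Z.rcos_self[OF q subgroup_B])
  ultimately have "(\<lambda>p. B #>\<^bsub>Z\<^esub> cocycle_twist H I c p) ` (B #>\<^bsub>Z\<^esub> q) =
      {B #>\<^bsub>Z\<^esub> cocycle_twist H I c q}"
    by blast
  then show ?thesis by (simp add: H2_act_def)
qed

text \<open>Twisting is a right action because it precomposes with \<phi> and applies the inverse of
  \<psi>, and both operations reverse the order of composition.\<close>

lemma cocycle_twist_compose: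
  assumes p: "p \<in> carrier Z" and c: "c \<in> carrier C\<mu>" "c' \<in> carrier C\<mu>"
  shows "cocycle_twist H I (c \<otimes>\<^bsub>C\<mu>\<^esub> c') p = cocycle_twist H I c' (cocycle_twist H I c p)"
proof -
  obtain \<phi> \<psi> where c_eq [simp]: "c = (\<phi>, \<psi>)" by (cases c)
  obtain \<phi>' \<psi>' where c'_eq [simp]: "c' = (\<phi>', \<psi>')" by (cases c')
  have \<phi>: "\<phi> \<in> rb_auto H RH" "\<phi>' \<in> rb_auto H RH" and \<psi>: "\<psi> \<in> rb_auto I RI" "\<psi>' \<in> rb_auto I RI"
    using c by (auto simp: C_mu_iff)
  have inv: "inv_into (carrier I) (compose (carrier I) \<psi> \<psi>') y =
      inv_into (carrier I) \<psi>' (inv_into (carrier I) \<psi> y)" if "y \<in> carrier I" for y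
  proof (rule inj_onD[OF rb_autoD(2)[OF I.compose_rb_auto[OF \<psi>]]])
    note \<psi>1 = rb_autoD(8,10)[OF \<psi>(1)] and \<psi>2 = rb_autoD(8,10)[OF \<psi>(2)]
    show "compose (carrier I) \<psi> \<psi>' (inv_into (carrier I) (compose (carrier I) \<psi> \<psi>') y) =
        compose (carrier I) \<psi> \<psi>' (inv_into (carrier I) \<psi>' (inv_into (carrier I) \<psi> y))"
      unfolding rb_autoD(10)[OF I.compose_rb_auto[OF \<psi>] that]
      using that by (simp add: compose_eq \<psi>1 \<psi>2)
    show "inv_into (carrier I) (compose (carrier I) \<psi> \<psi>') y \<in> carrier I"
      by (rule rb_autoD(8)[OF I.compose_rb_auto[OF \<psi>] that])
    show "inv_into (carrier I) \<psi>' (inv_into (carrier I) \<psi> y) \<in> carrier I"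
      using that by (simp add: \<psi>1 \<psi>2)
  qed
  obtain t g where p_eq [simp]: "p = (t, g)" by (cases p)
  have tg: "t \<in> carrier (C2 H I)" "g \<in> carrier (C1 H I)" using C_of_Z p by auto
  show ?thesis
    using c by (auto simp: C_mu_mult cocycle_twist_def inv compose_eq C2_closed[OF tg(1)] C1_closed[OF tg(2)]
        rb_autoD(5)[OF \<phi>(1)] rb_autoD(5)[OF \<phi>(2)] intro!: restrict_ext)
qed

end

context rb_section
begin

text \<open>A telescoping sum: with p^c for the twist, p^(cc') - p = (p^c - p)^c' + (p^c' - p),
  where p^(cc') = (p^c)^c'.\<close>

lemma omega_derivation:
  assumes c: "c \<in> carrier C\<mu>" "c' \<in> carrier C\<mu>"
  shows "\<omega> (c \<otimes>\<^bsub>C\<mu>\<^esub> c') = H2_act H RH I RI mu (\<omega> c) c' \<otimes>\<^bsub>K\<^esub> \<omega> c'"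
proof -
  interpret C\<mu>: group C\<mu> by (rule group_C_mu)
  obtain p where p: "p \<in> carrier Z" "ext_equiv I (E p) X" by (rule cocycle_exists)
  let ?T = "cocycle_twist H I"
  note tw = cocycle_twist_in_Z(1)
  have [simp]: "?T c p \<in> carrier Z" "?T c' p \<in> carrier Z" "?T c' (?T c p) \<in> carrier Z"
    "?T c' (inv\<^bsub>Z\<^esub> p) \<in> carrier Z"
    using tw p c by auto
  have "?T c' (inv\<^bsub>Z\<^esub> p) \<otimes>\<^bsub>Z\<^esub> ?T c' p = ?T c' \<one>\<^bsub>Z\<^esub>"
    using p c by (simp flip: cocycle_twist_mult)
  \<comment> \<open>Additivity makes the twist of zero idempotent, hence zero. With the preceding
    equation, the twist of the negative of \<open>p\<close> is the negative of the twist of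
    \<open>p\<close>.\<close>
  moreover have "?T c' \<one>\<^bsub>Z\<^esub> \<otimes>\<^bsub>Z\<^esub> ?T c' \<one>\<^bsub>Z\<^esub> = ?T c' \<one>\<^bsub>Z\<^esub>"
    using c by (simp flip: cocycle_twist_mult)
  then have "?T c' \<one>\<^bsub>Z\<^esub> = \<one>\<^bsub>Z\<^esub>"
    using tw[OF Z.one_closed c(2)] by simp
  ultimately have inv: "?T c' (inv\<^bsub>Z\<^esub> p) \<otimes>\<^bsub>Z\<^esub> ?T c' p = \<one>\<^bsub>Z\<^esub>" by simp
  have "H2_act H RH I RI mu (\<omega> c) c' \<otimes>\<^bsub>K\<^esub> \<omega> c' =
      B #>\<^bsub>Z\<^esub> (?T c' (?T c p \<otimes>\<^bsub>Z\<^esub> inv\<^bsub>Z\<^esub> p) \<otimes>\<^bsub>Z\<^esub> (?T c' p \<otimes>\<^bsub>Z\<^esub> inv\<^bsub>Z\<^esub> p))"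
    using p c tw by (simp add: omega_eq(1)[OF p] H2_act_coset H2_mult)
  also have "?T c' (?T c p \<otimes>\<^bsub>Z\<^esub> inv\<^bsub>Z\<^esub> p) \<otimes>\<^bsub>Z\<^esub> (?T c' p \<otimes>\<^bsub>Z\<^esub> inv\<^bsub>Z\<^esub> p)
      = ?T c' (?T c p) \<otimes>\<^bsub>Z\<^esub> (?T c' (inv\<^bsub>Z\<^esub> p) \<otimes>\<^bsub>Z\<^esub> ?T c' p) \<otimes>\<^bsub>Z\<^esub> inv\<^bsub>Z\<^esub> p"
    using p c by (simp add: cocycle_twist_mult Z.m_assoc)
  also have "\<dots> = ?T c' (?T c p) \<otimes>\<^bsub>Z\<^esub> inv\<^bsub>Z\<^esub> p"
    using p by (simp add: inv)
  finally show ?thesis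
    using p c by (simp add: omega_eq(1)[OF p] cocycle_twist_compose)
qed

section \<open>Restriction to \<open>H\<close> and \<open>I\<close>\<close>

lemma Aut_I_carrier:
  "\<gamma> \<in> carrier (Aut_I I X) \<longleftrightarrow>
     \<gamma> \<in> rb_auto (mid X) (rbop X) \<and> \<gamma> ` (incl X ` carrier I) = incl X ` carrier I"
  by (simp add: Aut_I_def)

lemma Aut_I_eq: "Aut_I I X = BijGroup (carrier (mid X))\<lparr>carrier := carrier (Aut_I I X)\<rparr>"
  by (simp add: Aut_I_def G.rb_AutoGroup_eq)

lemma group_Aut_I: "group (Aut_I I X)"
proof -
  let ?J = "incl X ` carrier I"
  have J: "?J \<subseteq> carrier (mid X)" by auto
  have "subgroup (carrier (Aut_I I X)) (BijGroup (carrier (mid X)))"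
  proof (rule subgroup_BijGroup)
    show "carrier (Aut_I I X) \<subseteq> Bij (carrier (mid X))"
      using G.rb_auto_Bij by (auto simp: Aut_I_carrier)
    show "(\<lambda>x\<in>carrier (mid X). x) \<in> carrier (Aut_I I X)"
      using J by (auto simp: Aut_I_carrier G.id_rb_auto image_iff)
    fix f assume f: "f \<in> carrier (Aut_I I X)"
    then have f': "f \<in> rb_auto (mid X) (rbop X)" "f ` ?J = ?J" by (auto simp: Aut_I_carrier)
    have "restrict (inv_into (carrier (mid X)) f) (carrier (mid X)) ` ?J =
        inv_into (carrier (mid X)) f ` ?J"
      using J by (intro image_cong) auto
    also have "\<dots> = inv_into (carrier (mid X)) f ` f ` ?J" by (simp only: f')
    also have "\<dots> = ?J"
      by (rule inv_into_image_cancel[OF rb_autoD(2)[OF f'(1)] J])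
    finally show "restrict (inv_into (carrier (mid X)) f) (carrier (mid X)) \<in> carrier (Aut_I I X)"
      using f' by (simp add: Aut_I_carrier G.inv_rb_auto)
    fix g assume "g \<in> carrier (Aut_I I X)"
    then have g: "g \<in> rb_auto (mid X) (rbop X)" "g ` ?J = ?J" by (auto simp: Aut_I_carrier)
    have "compose (carrier (mid X)) f g ` ?J = f ` g ` ?J"
      using J by (auto simp: compose_def image_iff)
    then show "compose (carrier (mid X)) f g \<in> carrier (Aut_I I X)"
      using f' g by (simp only: Aut_I_carrier G.compose_rb_auto)
  qed
  then show ?thesis
    by (subst Aut_I_eq) (rule subgroup.subgroup_is_group[OF _ group_BijGroup])
qed

lemma Aut_I_mult:
  "\<gamma> \<in> carrier (Aut_I I X) \<Longrightarrow> \<gamma>' \<in> carrier (Aut_I I X) \<Longrightarrow>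
    \<gamma> \<otimes>\<^bsub>Aut_I I X\<^esub> \<gamma>' = compose (carrier (mid X)) \<gamma> \<gamma>'"
  unfolding Aut_I_carrier by (simp add: Aut_I_def G.rb_AutoGroup_simps)

context
  fixes \<gamma> assumes \<gamma>: "\<gamma> \<in> carrier (Aut_I I X)"
begin

lemma \<gamma>_rb_auto: "\<gamma> \<in> rb_auto (mid X) (rbop X)"
  using \<gamma> by (simp add: Aut_I_carrier)

lemma aut_incl:
  assumes "y \<in> carrier I"
  shows aut_restr_closed: "aut_restr I X \<gamma> y \<in> carrier I"
    and incl_aut_restr: "incl X (aut_restr I X \<gamma> y) = \<gamma> (incl X y)"
proof -
  have "\<gamma> (incl X y) \<in> incl X ` carrier I"
    using \<gamma> assms by (auto simp: Aut_I_carrier)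
  then show "aut_restr I X \<gamma> y \<in> carrier I" "incl X (aut_restr I X \<gamma> y) = \<gamma> (incl X y)"
    using assms by (auto simp: aut_restr_def extD(6))
qed

text \<open>Independence of the section: an element differs from the section value below it by a
  member of I, whose image stays in I and vanishes under the projection.\<close>

lemma proj_aut:
  assumes x: "x \<in> carrier (mid X)"
  shows "proj X (\<gamma> x) = aut_ind H X s \<gamma> (proj X x)"
proof -
  obtain y where y: "y \<in> carrier I" "x = s (proj X x) \<star> incl X y"
    using fibre[of x "s (proj X x)"] x by auto
  have "\<gamma> x = \<gamma> (s (proj X x)) \<star> incl X (aut_restr I X \<gamma> y)"
    using x y(1) by (subst y(2)) (simp add: rb_autoD(6)[OF \<gamma>_rb_auto] incl_aut_restr)
  then show ?thesis
    using x y(1) by (simp add: aut_ind_def aut_restr_closed rb_autoD(5)[OF \<gamma>_rb_auto])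
qed

lemma aut_ind_rb_auto: "aut_ind H X s \<gamma> \<in> rb_auto H RH"
proof (rule rb_autoI)
  note g = rb_autoD[OF \<gamma>_rb_auto]
  let ?\<phi> = "aut_ind H X s \<gamma>"
  have ind: "?\<phi> h = proj X (\<gamma> (s h))" if "h \<in> carrier H" for h
    using that by (simp add: aut_ind_def)
  show "?\<phi> \<in> extensional (carrier H)" by (simp add: aut_ind_def)
  show mult: "?\<phi> (h \<cdot> k) = ?\<phi> h \<cdot> ?\<phi> k" if "h \<in> carrier H" "k \<in> carrier H" for h k
    using that proj_aut[of "s h \<star> s k"] by (simp add: ind g(5,6))
  show "?\<phi> (RH h) = RH (?\<phi> h)" if "h \<in> carrier H" for h
    using that proj_aut[of "rbop X (s h)"] by (simp add: ind g(5,7) extD(5))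
  have "?\<phi> \<in> hom H H"
    using mult by (auto simp: hom_def ind g(5))
  then interpret \<phi>: group_hom H H ?\<phi> by unfold_locales
  have "h = \<one>\<^bsub>H\<^esub>" if h: "h \<in> carrier H" "?\<phi> h = \<one>\<^bsub>H\<^esub>" for h
  proof -
    \<comment> \<open>Here the image of I must be all of I: an element of I is the image of an
      element of I, so injectivity of \<gamma> puts \<open>s h\<close> itself into I.\<close>
    have "\<gamma> (s h) \<in> \<gamma> ` (incl X ` carrier I)"
      using \<gamma> h by (simp add: Aut_I_carrier incl_image_iff ind g(5))
    then obtain y where "y \<in> carrier I" "\<gamma> (s h) = \<gamma> (incl X y)" by auto
    then have "s h = incl X y"
      using h by (auto intro: inj_onD[OF g(2)])
    then show ?thesis using h \<open>y \<in> carrier I\<close> by (metis proj_s proj_incl)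
  qed
  then show "inj_on ?\<phi> (carrier H)" by (simp add: \<phi>.inj_on_one_iff)
  show "?\<phi> ` carrier H = carrier H"
  proof (intro equalityI subsetI)
    fix h assume h: "h \<in> carrier H"
    then have "s h \<in> \<gamma> ` carrier (mid X)" by (simp add: g(3))
    then obtain x where "x \<in> carrier (mid X)" "s h = \<gamma> x" by auto
    then show "h \<in> ?\<phi> ` carrier H"
      using h proj_aut[of x] by (intro image_eqI[of _ _ "proj X x"]) (auto dest: arg_cong[of _ _ "proj X"])
  qed auto
qed

lemma aut_restr_rb_auto: "aut_restr I X \<gamma> \<in> rb_auto I RI"
proof (rule rb_autoI)
  note g = rb_autoD[OF \<gamma>_rb_auto]
  let ?\<psi> = "aut_restr I X \<gamma>"
  note [simp] = aut_restr_closed incl_aut_restr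
  have eqI: "x = y" if "incl X x = incl X y" "x \<in> carrier I" "y \<in> carrier I" for x y
    using that by simp
  show "?\<psi> \<in> extensional (carrier I)" by (simp add: aut_restr_def)
  show "?\<psi> (x \<^bold>+ y) = ?\<psi> x \<^bold>+ ?\<psi> y" if "x \<in> carrier I" "y \<in> carrier I" for x y
    by (rule eqI) (use that in \<open>simp_all add: g(6)\<close>)
  show "?\<psi> (RI x) = RI (?\<psi> x)" if "x \<in> carrier I" for x
    by (rule eqI) (use that in \<open>simp_all add: g(7) extD(4)\<close>)
  show "inj_on ?\<psi> (carrier I)"
  proof (rule inj_onI)
    fix x y assume xy: "x \<in> carrier I" "y \<in> carrier I" "?\<psi> x = ?\<psi> y"
    then have "\<gamma> (incl X x) = \<gamma> (incl X y)" by (metis incl_aut_restr)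
    then have "incl X x = incl X y" using xy by (auto intro!: inj_onD[OF g(2)] simp del: incl_inject)
    then show "x = y" using xy by simp
  qed
  show "?\<psi> ` carrier I = carrier I"
  proof (intro equalityI subsetI)
    fix y assume y: "y \<in> carrier I"
    \<comment> \<open>Surjectivity on I again rests on \<gamma> mapping I onto itself.\<close>
    then have "incl X y \<in> \<gamma> ` (incl X ` carrier I)" using \<gamma> by (simp add: Aut_I_carrier)
    then obtain z where z: "z \<in> carrier I" "incl X y = \<gamma> (incl X z)" by auto
    then have "incl X y = incl X (?\<psi> z)" by simp
    then have "y = ?\<psi> z" using y z(1) by (simp del: incl_aut_restr)
    then show "y \<in> ?\<psi> ` carrier I" using z(1) by simp
  qed auto
qed

text \<open>Compatibility results from comparing two forms of the conjugation rule: the image under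
  \<gamma> of the rule at \<open>s h\<close>, and the rule at \<gamma> applied to
  \<open>s h\<close>, an element lying over the induced image of \<open>h\<close>.\<close>

lemma rho_closed: "rho H I X s \<gamma> \<in> carrier C\<mu>"
proof -
  let ?\<phi> = "aut_ind H X s \<gamma>" and ?\<psi> = "aut_restr I X \<gamma>"
  note g = rb_autoD[OF \<gamma>_rb_auto]
  note [simp] = aut_restr_closed incl_aut_restr
  have "?\<psi> (mu h y) = mu (?\<phi> h) (?\<psi> y)" if [simp]: "h \<in> carrier H" "y \<in> carrier I" for h y
  proof -
    have [simp]: "?\<phi> h \<in> carrier H" by (simp add: rb_autoD(5)[OF aut_ind_rb_auto])
    have "\<gamma> (s h) \<star> incl X (?\<psi> (mu h y)) = \<gamma> (s h \<star> incl X (mu h y))"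
      by (simp add: g(6))
    also have "\<dots> = incl X (?\<psi> y) \<star> \<gamma> (s h)"
      using conj_incl[of "s h" y] by (simp add: g(6))
    also have "\<dots> = \<gamma> (s h) \<star> incl X (mu (?\<phi> h) (?\<psi> y))"
      using conj_incl[of "\<gamma> (s h)" "?\<psi> y"] by (simp add: proj_aut g(5) del: incl_aut_restr)
    finally show ?thesis by (simp add: g(5) del: incl_aut_restr)
  qed
  then show ?thesis by (simp add: rho_def C_mu_iff aut_ind_rb_auto aut_restr_rb_auto)
qed

lemma ext_equiv_rho: "ext_equiv I X (ext_twist H X (rho H I X s \<gamma>))"
  unfolding ext_equiv_def
proof (intro bexI[of _ \<gamma>] conjI ballI)
  note g = rb_autoD[OF \<gamma>_rb_auto]
  show "\<gamma> \<in> iso (mid X) (mid (ext_twist H X (rho H I X s \<gamma>))) \<inter>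
      rb_hom (mid X) (rbop X) (mid (ext_twist H X (rho H I X s \<gamma>))) (rbop (ext_twist H X (rho H I X s \<gamma>)))"
    using g(2-4) by (auto simp: ext_twist_def rho_def iso_def bij_betw_def rb_hom_def g(7))
  show "\<gamma> (incl X y) = incl (ext_twist H X (rho H I X s \<gamma>)) y" if "y \<in> carrier I" for y
    using that by (simp add: ext_twist_def rho_def incl_aut_restr)
  show "proj (ext_twist H X (rho H I X s \<gamma>)) (\<gamma> x) = proj X x" if "x \<in> carrier (mid X)" for x
    using that by (simp add: ext_twist_def rho_def proj_aut rb_autoD(9)[OF aut_ind_rb_auto])
qed

end

lemma rho_hom: "rho H I X s \<in> hom (Aut_I I X) C\<mu>"
proof (rule homI)
  fix \<gamma> \<gamma>' assume g: "\<gamma> \<in> carrier (Aut_I I X)" "\<gamma>' \<in> carrier (Aut_I I X)"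
  note g' = g[THEN \<gamma>_rb_auto]
  have "aut_ind H X s (\<gamma> \<otimes>\<^bsub>Aut_I I X\<^esub> \<gamma>') = compose (carrier H) (aut_ind H X s \<gamma>) (aut_ind H X s \<gamma>')"
  proof (rule extensionalityI[of _ "carrier H"])
    fix h assume h: "h \<in> carrier H"
    have "aut_ind H X s (\<gamma> \<otimes>\<^bsub>Aut_I I X\<^esub> \<gamma>') h = proj X (\<gamma> (\<gamma>' (s h)))"
      using h by (simp add: aut_ind_def Aut_I_mult[OF g] compose_eq)
    then show "aut_ind H X s (\<gamma> \<otimes>\<^bsub>Aut_I I X\<^esub> \<gamma>') h =
        compose (carrier H) (aut_ind H X s \<gamma>) (aut_ind H X s \<gamma>') h"
      using h by (simp add: proj_aut[OF g(1)] proj_aut[OF g(2)] compose_eq rb_autoD(5)[OF g'(2)])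
  qed (simp_all only: compose_extensional, simp add: aut_ind_def)
  moreover have "aut_restr I X (\<gamma> \<otimes>\<^bsub>Aut_I I X\<^esub> \<gamma>') = compose (carrier I) (aut_restr I X \<gamma>) (aut_restr I X \<gamma>')"
  proof (rule extensionalityI[of _ "carrier I"])
    fix y assume y: "y \<in> carrier I"
    have "aut_restr I X (\<gamma> \<otimes>\<^bsub>Aut_I I X\<^esub> \<gamma>') y = inv_into (carrier I) (incl X) (\<gamma> (\<gamma>' (incl X y)))"
      using y by (simp add: aut_restr_def Aut_I_mult[OF g] compose_eq)
    also have "\<dots> = aut_restr I X \<gamma> (aut_restr I X \<gamma>' y)"
      using aut_restr_closed[OF g(2) y] by (simp add: aut_restr_def[of I X \<gamma>] incl_aut_restr[OF g(2) y])
    finally show "aut_restr I X (\<gamma> \<otimes>\<^bsub>Aut_I I X\<^esub> \<gamma>') y =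
        compose (carrier I) (aut_restr I X \<gamma>) (aut_restr I X \<gamma>') y"
      using y by (simp add: compose_eq)
  qed (simp_all only: compose_extensional, simp add: aut_restr_def)
  ultimately show "rho H I X s (\<gamma> \<otimes>\<^bsub>Aut_I I X\<^esub> \<gamma>') = rho H I X s \<gamma> \<otimes>\<^bsub>C\<mu>\<^esub> rho H I X s \<gamma>'"
    using C_mu_mult[OF rho_closed[OF g(1), unfolded rho_def] rho_closed[OF g(2), unfolded rho_def]]
    by (simp only: rho_def)
qed (rule rho_closed)

lemma Aut_HI_eq_kernel: "carrier (Aut_HI H I X s) = kernel (Aut_I I X) C\<mu> (rho H I X s)"
  by (auto simp: Aut_HI_def kernel_def rho_def C_mu_one)

lemma group_Aut_HI: "group (Aut_HI H I X s)"
proof -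
  interpret A: group "Aut_I I X" by (rule group_Aut_I)
  interpret C: group C\<mu> by (rule group_C_mu)
  interpret rho: group_hom "Aut_I I X" C\<mu> "rho H I X s"
    by unfold_locales (rule rho_hom)
  have "Aut_HI H I X s = Aut_I I X\<lparr>carrier := kernel (Aut_I I X) C\<mu> (rho H I X s)\<rparr>"
    by (simp only: Aut_HI_eq_kernel[symmetric]) (simp add: Aut_I_def Aut_HI_def)
  then show ?thesis
    using subgroup.subgroup_is_group[OF rho.subgroup_kernel A.is_group] by simp
qed

lemma Aut_HI_mon: "(\<lambda>\<gamma>. \<gamma>) \<in> mon (Aut_HI H I X s) (Aut_I I X)"
  by (auto simp: mon_def hom_def Aut_HI_def Aut_I_def)

text \<open>Neither \<open>X\<close> nor \<open>Y\<close> need live on the type of the class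
  members, so both are compared with \<open>E p\<close>, and the two equivalences are
  composed.\<close>

lemma cls_eqD:
  assumes "rb_extension H RH I RI Y" "cls Y = cls X"
  shows "ext_equiv I X Y"
proof -
  obtain p where p: "p \<in> carrier Z" "ext_equiv I (E p) X" by (rule cocycle_exists)
  note Ep = rb_extension_E[OF p(1)]
  have "cls X = cls (E p)" using ext_class_cong[OF Ep ext p(2)] by simp
  then have "ext_equiv I Y (E p)" "ext_equiv I X (E p)"
    using ext_class_eq_iff[OF assms(1) Ep] ext_class_eq_iff[OF ext Ep] assms(2) by simp_all
  then show ?thesis
    using ext_equiv_trans[OF _ ext_equiv_sym[OF assms(1) Ep]] by simp
qed

lemma fixed_class_in_rho_image:
  assumes c: "c \<in> carrier C\<mu>" and cls: "cls (ext_twist H X c) = cls X"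
  shows "c \<in> rho H I X s ` carrier (Aut_I I X)"
proof -
  obtain \<phi> \<psi> where c_eq [simp]: "c = (\<phi>, \<psi>)" by (cases c)
  have \<phi>: "\<phi> \<in> rb_auto H RH" and \<psi>: "\<psi> \<in> rb_auto I RI" using c by (auto simp: C_mu_iff)
  have "ext_equiv I X (ext_twist H X c)"
    using cls_eqD[OF rb_extension_twist[OF ext] cls[unfolded c_eq]] c by simp
  then obtain f where f: "f \<in> iso (mid X) (mid X)" "f \<in> rb_hom (mid X) (rbop X) (mid X) (rbop X)"
    "\<And>y. y \<in> carrier I \<Longrightarrow> f (incl X y) = incl X (\<psi> y)"
    "\<And>x. x \<in> carrier (mid X) \<Longrightarrow> inv_into (carrier H) \<phi> (proj X (f x)) = proj X x"
    by (auto simp: ext_equiv_def ext_twist_def)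
  \<comment> \<open>Members of \<open>rb_auto\<close> are extensional, whereas the isomorphism
    \<open>f\<close> may take any values outside the carrier.\<close>
  define \<gamma> where "\<gamma> = restrict f (carrier (mid X))"
  have fc: "f x \<in> carrier (mid X)" if "x \<in> carrier (mid X)" for x
    using f(1) that by (auto simp: iso_def hom_def)
  have "\<gamma> \<in> rb_auto (mid X) (rbop X)"
    using f(1,2) by (intro rb_autoI) (auto simp: \<gamma>_def iso_def bij_betw_def inj_on_def rb_hom_def hom_def)
  \<comment> \<open>Since \<psi> is onto, this image is all of I, as \<open>Aut_I\<close>
    demands.\<close>
  moreover have "\<gamma> ` (incl X ` carrier I) = incl X ` \<psi> ` carrier I"
    unfolding image_image by (intro image_cong) (simp_all add: \<gamma>_def f(3))
  ultimately have \<gamma>: "\<gamma> \<in> carrier (Aut_I I X)"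
    by (simp only: Aut_I_carrier rb_autoD(3)[OF \<psi>])
  have "aut_ind H X s \<gamma> h = \<phi> h" if h: "h \<in> carrier H" for h
  proof -
    have "\<phi> h = \<phi> (inv_into (carrier H) \<phi> (proj X (f (s h))))" using f(4)[of "s h"] h by simp
    also have "\<dots> = proj X (f (s h))" using h fc by (simp add: rb_autoD(10)[OF \<phi>])
    finally show ?thesis using h by (simp add: aut_ind_def \<gamma>_def)
  qed
  moreover have "aut_restr I X \<gamma> y = \<psi> y" if "y \<in> carrier I" for y
    using that f(3) extD(6) by (simp add: aut_restr_def \<gamma>_def rb_autoD(5)[OF \<psi>])
  ultimately have "rho H I X s \<gamma> = c"
    using rb_autoD(1)[OF \<phi>] rb_autoD(1)[OF \<psi>]
    by (auto simp: rho_def intro!: extensionalityI[of _ "carrier H"] extensionalityI[of _ "carrier I"])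
      (simp_all add: aut_ind_def aut_restr_def)
  with \<gamma> show ?thesis by blast
qed

lemma kernel_omega:
  "kernel C\<mu> K \<omega> = {c \<in> carrier C\<mu>. cls (ext_twist H X c) = cls X}"
  using omega_eq_one_iff by (auto simp: kernel_def)

lemma rho_image: "rho H I X s ` carrier (Aut_I I X) = kernel C\<mu> K \<omega>"
proof (intro equalityI subsetI)
  fix c assume "c \<in> rho H I X s ` carrier (Aut_I I X)"
  then obtain \<gamma> where \<gamma>: "\<gamma> \<in> carrier (Aut_I I X)" and c: "c = rho H I X s \<gamma>" by auto
  have cC: "c \<in> carrier C\<mu>" using rho_closed[OF \<gamma>] c by simp
  then have "rb_extension H RH I RI (ext_twist H X c)"
    using rb_extension_twist[OF ext] by (cases c) auto
  then show "c \<in> kernel C\<mu> K \<omega>"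
    using cC ext_class_cong[OF ext _ ext_equiv_rho[OF \<gamma>]] by (simp add: kernel_omega c)
qed (auto simp: kernel_omega intro: fixed_class_in_rho_image)

end

text \<open>An equivalence with some \<open>Y\<close> of action \<open>mu\<close> carries sections
  of \<open>X\<close> to sections of \<open>Y\<close>; the conjugation formula holds there and is
  reflected by the injective map.\<close>

lemma has_action_if_in_Ext_mu:
  fixes H :: "'h monoid" and I :: "'i monoid"
  assumes X: "rb_extension H RH I RI X" and "ext_class H RH I RI X \<in> Ext_mu H RH I RI mu"
    and mu: "\<And>h y. h \<in> carrier H \<Longrightarrow> y \<in> carrier I \<Longrightarrow> mu h y \<in> carrier I"
  shows "has_action H I X mu"
proof -
  obtain Y :: "('h, 'i, 'h \<times> 'i) rb_ext" where Y: "rb_extension H RH I RI Y" "has_action H I Y mu"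
    "ext_class H RH I RI X = ext_class H RH I RI Y"
    using assms(2) by (auto simp: Ext_mu_def)
  then have "ext_equiv I X Y" using ext_class_eq_iff[OF X Y(1)] by simp
  then obtain f where f: "f \<in> iso (mid X) (mid Y)"
    "\<And>y. y \<in> carrier I \<Longrightarrow> f (incl X y) = incl Y y"
    "\<And>x. x \<in> carrier (mid X) \<Longrightarrow> proj Y (f x) = proj X x"
    by (auto simp: ext_equiv_def)
  interpret G: group "mid X" by (rule rb_extensionD(1)[OF X])
  interpret G': group "mid Y" by (rule rb_extensionD(1)[OF Y(1)])
  interpret f: group_hom "mid X" "mid Y" f using f(1) by unfold_locales (simp add: iso_def)
  have inj: "inj_on f (carrier (mid X))" using f(1) by (simp add: iso_def bij_betw_def)
  show ?thesis
    unfolding has_action_def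
  proof (intro allI impI ballI)
    fix s h y assume s: "st_section H X s" and hy: "h \<in> carrier H" "y \<in> carrier I"
    have sh: "s h \<in> carrier (mid X)" using s hy by (auto simp: st_section_def)
    have "st_section H Y (f \<circ> s)"
      using s by (simp add: st_section_def f(3) Pi_iff)
    then have "incl Y (mu h y) = inv\<^bsub>mid Y\<^esub> f (s h) \<otimes>\<^bsub>mid Y\<^esub> incl Y y \<otimes>\<^bsub>mid Y\<^esub> f (s h)"
      using Y(2) hy by (auto simp: has_action_def)
    also have "\<dots> = f (inv\<^bsub>mid X\<^esub> (s h) \<otimes>\<^bsub>mid X\<^esub> incl X y \<otimes>\<^bsub>mid X\<^esub> s h)"
      using hy sh rb_extensionD(7)[OF X] by (simp flip: f(2))
    finally show "incl X (mu h y) = inv\<^bsub>mid X\<^esub> (s h) \<otimes>\<^bsub>mid X\<^esub> incl X y \<otimes>\<^bsub>mid X\<^esub> s h"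
      using hy sh rb_extensionD(7)[OF X] mu
      by (intro inj_onD[OF inj]) (simp_all add: f(2))
  qed
qed

section \<open>An example where \<open>\<omega>\<close> is not a homomorphism\<close>

text \<open>With trivial operators and trivial action a cocycle \<open>(0, g)\<close> is a homomorphism \<open>g\<close>
  and coboundaries have second component \<open>0\<close>.  For \<open>g = id\<close> on the integers and \<open>c = (-id, id)\<close>,
  \<open>c\<close> is an involution, but \<open>\<omega> c\<close> has second component \<open>-2 id\<close>, of infinite order.\<close>

lemma omega_not_hom:
  "\<exists>(H' :: int monoid) RH' (I' :: int monoid) RI' mu' (X' :: (int, int, int \<times> int) rb_ext).
     rb_module H' RH' I' RI' mu' \<and> rb_extension H' RH' I' RI' X' \<and>
     ext_class H' RH' I' RI' X' \<in> Ext_mu H' RH' I' RI' mu' \<and>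
     omega H' RH' I' RI' mu' X' \<notin> hom (C_mu H' RH' I' RI' mu') (H2 H' RH' I' RI' mu')"
proof -
  interpret int: comm_group integer_group by (rule abelian_integer_group)
  \<comment> \<open>Local constants, since interpreting with the abstractions themselves would turn simp rules
    such as \<open>RI (x + y) = RI x + RI y\<close> into the looping \<open>0 = 0 + 0\<close>.\<close>
  define N :: "int \<Rightarrow> int" where "N = (\<lambda>_. 0)"
  define M :: "int \<Rightarrow> int \<Rightarrow> int" where "M = (\<lambda>_ y. y)"
  interpret rb_module integer_group N integer_group N M
    by unfold_locales (auto simp: iso_set_refl N_def M_def)
  \<comment> \<open>The carrier of \<open>integer_group\<close> is the whole type, so unrestricted
    functions are already extensional cochains.\<close>
  define p :: "(int \<times> int \<Rightarrow> int) \<times> (int \<Rightarrow> int)" where "p = (\<lambda>_. 0, \<lambda>x. x)"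
  have p: "p \<in> carrier Z"
    unfolding p_def Z2_carrier C1_carrier C2_carrier by (simp add: rb_circ_def N_def M_def)
  have ext: "rb_extension integer_group N integer_group N (E p)"
    by (rule rb_extension_E[OF p])
  have act: "has_action integer_group integer_group (E p) M"
    by (rule has_action_E[OF p])
  interpret rb_section integer_group N integer_group N M "E p" "\<lambda>h. (h, 0)"
    using ext act by unfold_locales (auto simp: st_section_def p_def)
  note \<omega> = omega_eq(1)[OF p ext_equiv_refl[OF ext]]
  define c :: "(int \<Rightarrow> int) \<times> (int \<Rightarrow> int)" where "c = (uminus, \<lambda>x. x)"
  have c: "c \<in> carrier C\<mu>"
    unfolding c_def C_mu_iff by (auto simp: N_def M_def rb_auto_iff bij_betw_def inj_on_def surj_def)
  have "\<omega> \<notin> hom C\<mu> K"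
  proof
    assume hom: "\<omega> \<in> hom C\<mu> K"
    interpret C: group C\<mu> by (rule group_C_mu)
    interpret K: comm_group K by (rule comm_group_H2)
    interpret \<omega>: group_hom C\<mu> K \<omega> using hom by unfold_locales
    define q where "q = cocycle_twist integer_group integer_group c p \<otimes>\<^bsub>Z\<^esub> inv\<^bsub>Z\<^esub> p"
    have q: "q \<in> carrier Z" using p c cocycle_twist_in_Z(1) by (simp add: q_def)
    have "c \<otimes>\<^bsub>C\<mu>\<^esub> c = \<one>\<^bsub>C\<mu>\<^esub>"
      using c by (simp add: c_def C_mu_mult C_mu_one compose_def)
    then have "\<omega> c \<otimes>\<^bsub>K\<^esub> \<omega> c = \<one>\<^bsub>K\<^esub>"
      using c \<omega>.hom_mult[of c c] by simp
    then have "B #>\<^bsub>Z\<^esub> (q \<otimes>\<^bsub>Z\<^esub> q) = B"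
      using c q by (simp add: \<omega> H2_mult flip: q_def) (simp add: H2_def)
    then have "q \<otimes>\<^bsub>Z\<^esub> q \<in> B"
      by (rule Z.coset_join1[OF _ Z.m_closed[OF q q] subgroup_B])
    then obtain \<theta> where \<theta>: "\<theta> \<in> carrier (C1 integer_group integer_group)"
      "q \<otimes>\<^bsub>Z\<^esub> q = cob \<theta>"
      by (auto simp: B2_eq)
    \<comment> \<open>\<open>Phi1\<close> vanishes at 1: the operators are zero, and \<theta> is
      normalised at \<open>N 1 = 0\<close>.\<close>
    have "snd (q \<otimes>\<^bsub>Z\<^esub> q) 1 = 0"
      unfolding \<theta>(2) cob_def Phi1_def using \<theta>(1) by (simp add: C1_carrier N_def)
    moreover obtain t g where r: "inv\<^bsub>Z\<^esub> p = (t, g)" by (metis surj_pair)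
    have "(t, g) \<otimes>\<^bsub>Z\<^esub> p = \<one>\<^bsub>Z\<^esub>" using p by (simp flip: r)
    then have "snd ((t, g) \<otimes>\<^bsub>Z\<^esub> p) 1 = snd \<one>\<^bsub>Z\<^esub> 1" by simp
    then have "g 1 = - 1" unfolding p_def Z_mult Z_one by simp
    moreover have "inv_into UNIV (\<lambda>x::int. x) y = y" for y
      by (rule inv_into_f_f[of "\<lambda>x. x"]) auto
    moreover have "q = cocycle_twist integer_group integer_group c p \<otimes>\<^bsub>Z\<^esub> (t, g)"
      by (simp only: q_def r)
    \<comment> \<open>The twist of the identity is negation, so \<open>q\<close> has second
      component -2h, and the double of \<open>q\<close> takes the value -4 at 1 in place of
      0.\<close>
    ultimately show False
      by (simp add: p_def c_def cocycle_twist_def Z_mult)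
  qed
  moreover have "cls (E p) \<in> Ext_mu integer_group N integer_group N M"
    using ext act by (auto simp: Ext_mu_def)
  ultimately show ?thesis
    using rb_module_axioms ext by blast
qed

theorem theorem7p5:
  fixes H :: "'h monoid" and RH :: "'h \<Rightarrow> 'h"
    and I :: "'i monoid" and RI :: "'i \<Rightarrow> 'i"
    and mu :: "'h \<Rightarrow> 'i \<Rightarrow> 'i"
    and X :: "('h, 'i, 'e) rb_ext" and s :: "'h \<Rightarrow> 'e"
  assumes "rb_module H RH I RI mu"
    and "rb_extension H RH I RI X"
    and "ext_class H RH I RI X \<in> Ext_mu H RH I RI mu"
    and "st_section H X s"
  shows
    "(group (Aut_HI H I X s) \<and> group (Aut_I I X) \<and>
      group (C_mu H RH I RI mu) \<and> comm_group (H2 H RH I RI mu)) \<and>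
     (\<lambda>\<gamma>. \<gamma>) \<in> mon (Aut_HI H I X s) (Aut_I I X) \<and>
     rho H I X s \<in> hom (Aut_I I X) (C_mu H RH I RI mu) \<and>
     omega H RH I RI mu X \<in> carrier (C_mu H RH I RI mu) \<rightarrow> carrier (H2 H RH I RI mu) \<and>
     (\<lambda>\<gamma>. \<gamma>) ` carrier (Aut_HI H I X s) =
       kernel (Aut_I I X) (C_mu H RH I RI mu) (rho H I X s) \<and>
     rho H I X s ` carrier (Aut_I I X) =
       kernel (C_mu H RH I RI mu) (H2 H RH I RI mu) (omega H RH I RI mu X) \<and>
     kernel (C_mu H RH I RI mu) (H2 H RH I RI mu) (omega H RH I RI mu X) =
       {c \<in> carrier (C_mu H RH I RI mu).
          ext_class H RH I RI (ext_twist H X c) = ext_class H RH I RI X} \<and>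
     (\<forall>c1\<in>carrier (C_mu H RH I RI mu). \<forall>c2\<in>carrier (C_mu H RH I RI mu).
        omega H RH I RI mu X (c1 \<otimes>\<^bsub>C_mu H RH I RI mu\<^esub> c2) =
        H2_act H RH I RI mu (omega H RH I RI mu X c1) c2
          \<otimes>\<^bsub>H2 H RH I RI mu\<^esub> omega H RH I RI mu X c2) \<and>
     (\<exists>(H' :: int monoid) RH' (I' :: int monoid) RI' mu' (X' :: (int, int, int \<times> int) rb_ext).
        rb_module H' RH' I' RI' mu' \<and> rb_extension H' RH' I' RI' X' \<and>
        ext_class H' RH' I' RI' X' \<in> Ext_mu H' RH' I' RI' mu' \<and>
        omega H' RH' I' RI' mu' X' \<notin> hom (C_mu H' RH' I' RI' mu') (H2 H' RH' I' RI' mu'))"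
proof -
  interpret rb_module H RH I RI mu by fact
  interpret rb_section H RH I RI mu X s
    using assms by unfold_locales (auto intro: has_action_if_in_Ext_mu)
  show ?thesis
    using group_Aut_HI group_Aut_I group_C_mu comm_group_H2 Aut_HI_mon rho_hom omega_closed
      Aut_HI_eq_kernel rho_image kernel_omega omega_derivation omega_not_hom
    by (intro conjI) (simp_all add: Pi_iff)
qed

end
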